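(* For every $n\in\mathbb N$ let $U_n:G_n\cap D\to\mathbb R$ be a solution of the discrete system (S$_n$) defined in the context, and let $u_n:\mathbb R^2\to\mathbb R$ be the associated convex function. Assume that, along some subsequence, $u_n$ converges uniformly on compact subsets of $\mathbb R^2$ to a function $v\in C^1(\mathbb R^2)$. Then for every compact $K\subset\mathrm{int}(D)$, along that subsequence, $$\lim_{n\to+\infty}\max_{x\in K\cap G_n}\bigl|\nabla^C_nU_n[x]-\nabla v(x)\bigr|=0,$$ $$\lim_{n\to+\infty}\max_{x\in K\cap G_n}\bigl|\nabla^F_nU_n[x]-\nabla v(x)\bigr|=0,$$ $$\lim_{n\to+\infty}\max_{x\in K\cap G_n}\bigl|\nabla^B_nU_n[x]-\nabla v(x)\bigr|=0,$$ where $\nabla_n^C,\nabla_n^F,\nabla_n^B$ are the centered, forward and backward finite difference gradients defined in the context.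
   Context: **Data.** $X\subset\mathbb R^2$ is a nonempty bounded open set with $0\in X$; $Y\subset\mathbb R^2$ is a nonempty bounded open convex set. $f$ is a (Lebesgue integrable) probability density on $X$, extended by $0$ outside $X$, with $m_f\le f\le M_f$ on $X$; $g:\mathbb R^2\to\mathbb R$ is continuous with $m_g\le g\le M_g$ and $\int_Y g=1$; here $m_f,M_f,m_g,M_g\in(0,+\infty)$. $\sigma(z)=\sup_{y\in\overline Y}\langle y,z\rangle$ is the support function of $\overline Y$. **Grid and directions.** $h_n>0$ decreases to $0$, $G_n=h_n\mathbb Z^2$, $D=[-1,1]^2$ contains $\overline X$ in its interior. A vector of $\mathbb Z^2$ is irreducible if its coordinates are coprime. $\mathcal V_n\subset\mathbb Z^2\setminus\{0\}$ are finite sets of irreducible vectors, and $Y_n=\{y\in\mathbb R^2:\langle y,e\rangle\le\sigma(e)\ \forall e\in\mathcal V_n\}$. It is assumed that: (1) $\{(\pm1,0),(0,\pm1)\}\subset\mathcal V_n$; (2) $\mathcal V_n\subset\mathcal V_{n'}$ for $n'\ge n$; (3) $\bigcap_n Y_n=\overline Y$; (4) $\overline X+h_n\mathcal V_n\subset D$ (discarding finitely many $n$). **Scheme.** For $U:G_n\cap D\to\mathbb R$ let $\delta_eU[x]=U[x+h_ne]-U[x]$, $\Delta_eU[x]=\delta_eU[x]+\delta_{-e}U[x]$ and $\Delta_e^+=\max(\Delta_e,0)$. A superbase is a triple $(e,e',e'')\in(\mathbb Z^2)^3$ with $e+e'+e''=0$ and $|\det(e',e'')|=1$. Define $$\mathrm{MA}(U)[x]=\frac1{h_n^4}\min_{(e,e',e'')}H\bigl(\Delta_e^+U[x],\Delta_{e'}^+U[x],\Delta_{e''}^+U[x]\bigr),$$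 the minimum being over superbases with $x\pm h_ne,\ x\pm h_ne',\ x\pm h_ne''\in D$, where for $a,b,c\ge0$: $H(a,b,c)=bc$ if $a\ge b+c$ (and likewise permuting $a,b,c$), and $H(a,b,c)=\frac12(ab+bc+ca)-\frac14(a^2+b^2+c^2)$ otherwise. Let $\tilde\delta_eU[x]=U[x+h_ne]-U[x]$ if $x+h_ne\in D$ and $\tilde\delta_eU[x]=\sigma(h_ne)$ otherwise; $\tilde\Delta_e=\tilde\delta_e+\tilde\delta_{-e}$; and $\widetilde{\mathrm{MA}}^0(U)[x]=\min_{e\in V(x)\cup\mathcal V_n}\tilde\Delta_eU[x]$, where $V(x)$ is the set of irreducible $e\in\mathbb Z^2\setminus\{0\}$ with $x\pm h_ne\in D$. Let $\bar f_n[x]=h_n^{-2}\int_{[-h_n/2,h_n/2]^2}f(x+t)\,dt$. $\nabla_n$ is a given discrete gradient, assigning to a grid function $U$ and $x\in G_n\cap\overline X$ a vector $\nabla_nU[x]\in\mathbb R^2$. A solution of (S$_n$) is a function $U_n:G_n\cap D\to\mathbb R$ such that $\mathrm{MA}(U_n)[x]=\bar f_n[x]/g(\nabla_nU_n[x])$ for $x\in G_n\cap X$, $\widetilde{\mathrm{MA}}^0(U_n)[x]=0$ for $x\in G_n\cap(D\setminus X)$, and $U_n[0]=0$. **Convex function $u_n$.** For $x\in\mathbb R^2$, $$u_n(x)=\sup_{y\in Y_n}\bigl(\langle x,y\rangle-U_n^*(y)\bigr),\qquad U_n^*(y)=\max_{x'\in G_n\cap D}\bigl(\langle y,x'\rangle-U_n[x']\bigr).$$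 **Finite differences** (defined at points of $K\cap G_n$ for $n$ large): $\nabla_n^CU[x]=\frac1{2h_n}\bigl(\delta_{(1,0)}U[x]-\delta_{(-1,0)}U[x],\ \delta_{(0,1)}U[x]-\delta_{(0,-1)}U[x]\bigr)$, $\nabla_n^FU[x]=\frac1{h_n}\bigl(\delta_{(1,0)}U[x],\ \delta_{(0,1)}U[x]\bigr)$, $\nabla_n^BU[x]=\frac1{h_n}\bigl(-\delta_{(-1,0)}U[x],\ -\delta_{(0,-1)}U[x]\bigr)$. *)

theory Defs
  imports "HOL-Analysis.Analysis"
begin

type_synonym plane = "real \<times> real"
type_synonym zvec = "int \<times> int"

definition of_zvec :: "zvec \<Rightarrow> plane" where
  "of_zvec e = (real_of_int (fst e), real_of_int (snd e))"

definition box_D :: "plane set" where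
  "box_D = {-1..1} \<times> {-1..1}"

text \<open>The parameter \<open>h\<close> below is the grid step; it is instantiated with \<open>h\<^sub>n\<close>.\<close>

definition grid :: "real \<Rightarrow> plane set" where
  "grid h = range (\<lambda>z. h *\<^sub>R of_zvec z)"

text \<open>A grid function is represented by a function on the whole plane that is extensional
  on \<open>grid h \<inter> box_D\<close>; it is only ever evaluated at points of that set, apart from the
  difference quotients, which are meaningful when the shifted points lie in \<open>box_D\<close>.\<close>

definition irreducible_zvec :: "zvec \<Rightarrow> bool" where
  "irreducible_zvec e \<longleftrightarrow> coprime (fst e) (snd e)"

definition support_fun :: "plane set \<Rightarrow> plane \<Rightarrow> real" where
  "support_fun Y z = (SUP y\<in>closure Y. y \<bullet> z)"

definition outer_polygon :: "plane set \<Rightarrow> zvec set \<Rightarrow> plane set" where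
  "outer_polygon Y V = {y. \<forall>e\<in>V. y \<bullet> of_zvec e \<le> support_fun Y (of_zvec e)}"

definition fdiff :: "real \<Rightarrow> zvec \<Rightarrow> (plane \<Rightarrow> real) \<Rightarrow> plane \<Rightarrow> real" where
  "fdiff h e U x = U (x + h *\<^sub>R of_zvec e) - U x"

definition sdiff :: "real \<Rightarrow> zvec \<Rightarrow> (plane \<Rightarrow> real) \<Rightarrow> plane \<Rightarrow> real" where
  "sdiff h e U x = fdiff h e U x + fdiff h (-e) U x"

definition sdiff_pos :: "real \<Rightarrow> zvec \<Rightarrow> (plane \<Rightarrow> real) \<Rightarrow> plane \<Rightarrow> real" where
  "sdiff_pos h e U x = max (sdiff h e U x) 0"

definition superbase :: "zvec \<times> zvec \<times> zvec \<Rightarrow> bool" where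
  "superbase = (\<lambda>(e, e', e''). e + e' + e'' = 0 \<and>
     \<bar>fst e' * snd e'' - snd e' * fst e''\<bar> = 1)"

text \<open>Both shifted points \<open>x \<plusminus> h e\<close> belong to the square.\<close>

definition admissible :: "real \<Rightarrow> plane \<Rightarrow> zvec \<Rightarrow> bool" where
  "admissible h x e \<longleftrightarrow>
     x + h *\<^sub>R of_zvec e \<in> box_D \<and> x - h *\<^sub>R of_zvec e \<in> box_D"

definition H_fun :: "real \<Rightarrow> real \<Rightarrow> real \<Rightarrow> real" where
  "H_fun a b c =
     (if a \<ge> b + c then b * c
      else if b \<ge> a + c then a * c
      else if c \<ge> a + b then a * b
      else (a * b + b * c + c * a) / 2 - (a\<^sup>2 + b\<^sup>2 + c\<^sup>2) / 4)"

definition MA :: "real \<Rightarrow> (plane \<Rightarrow> real) \<Rightarrow> plane \<Rightarrow> real" where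
  "MA h U x = 1 / h ^ 4 *
     Min ((\<lambda>(e, e', e''). H_fun (sdiff_pos h e U x) (sdiff_pos h e' U x) (sdiff_pos h e'' U x)) `
       {(e, e', e''). superbase (e, e', e'') \<and>
          admissible h x e \<and> admissible h x e' \<and> admissible h x e''})"

definition fdiff_bd :: "plane set \<Rightarrow> real \<Rightarrow> zvec \<Rightarrow> (plane \<Rightarrow> real) \<Rightarrow> plane \<Rightarrow> real" where
  "fdiff_bd Y h e U x =
     (if x + h *\<^sub>R of_zvec e \<in> box_D then U (x + h *\<^sub>R of_zvec e) - U x
      else support_fun Y (h *\<^sub>R of_zvec e))"

definition sdiff_bd :: "plane set \<Rightarrow> real \<Rightarrow> zvec \<Rightarrow> (plane \<Rightarrow> real) \<Rightarrow> plane \<Rightarrow> real" where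
  "sdiff_bd Y h e U x = fdiff_bd Y h e U x + fdiff_bd Y h (-e) U x"

definition MA0_bd :: "plane set \<Rightarrow> zvec set \<Rightarrow> real \<Rightarrow> (plane \<Rightarrow> real) \<Rightarrow> plane \<Rightarrow> real" where
  "MA0_bd Y V h U x =
     Min ((\<lambda>e. sdiff_bd Y h e U x) ` ({e. irreducible_zvec e \<and> admissible h x e} \<union> V))"

definition cell_average :: "(plane \<Rightarrow> real) \<Rightarrow> real \<Rightarrow> plane \<Rightarrow> real" where
  "cell_average f h x =
     (1 / h\<^sup>2) * (LINT t:({-h/2..h/2} \<times> {-h/2..h/2})|lebesgue. f (x + t))"

text \<open>The argument \<open>G\<close> is the given discrete gradient, a map from grid functions and grid
  points to vectors.\<close>

definition solves_scheme ::
  "plane set \<Rightarrow> plane set \<Rightarrow> (plane \<Rightarrow> real) \<Rightarrow> (plane \<Rightarrow> real) \<Rightarrow> zvec set \<Rightarrow>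
   ((plane \<Rightarrow> real) \<Rightarrow> plane \<Rightarrow> plane) \<Rightarrow> real \<Rightarrow> (plane \<Rightarrow> real) \<Rightarrow> bool" where
  "solves_scheme X Y f g V G h U \<longleftrightarrow>
     U \<in> extensional (grid h \<inter> box_D) \<and>
     (\<forall>x\<in>grid h \<inter> X. MA h U x = cell_average f h x / g (G U x)) \<and>
     (\<forall>x\<in>grid h \<inter> (box_D - X). MA0_bd Y V h U x = 0) \<and>
     U 0 = 0"

definition discrete_conj :: "real \<Rightarrow> (plane \<Rightarrow> real) \<Rightarrow> plane \<Rightarrow> real" where
  "discrete_conj h U y = Max ((\<lambda>x. y \<bullet> x - U x) ` (grid h \<inter> box_D))"

definition convex_ext :: "plane set \<Rightarrow> zvec set \<Rightarrow> real \<Rightarrow> (plane \<Rightarrow> real) \<Rightarrow> plane \<Rightarrow> real" where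
  "convex_ext Y V h U x = (SUP y\<in>outer_polygon Y V. x \<bullet> y - discrete_conj h U y)"

definition grad_C :: "real \<Rightarrow> (plane \<Rightarrow> real) \<Rightarrow> plane \<Rightarrow> plane" where
  "grad_C h U x = (1 / (2 * h)) *\<^sub>R
     (fdiff h (1, 0) U x - fdiff h (-1, 0) U x, fdiff h (0, 1) U x - fdiff h (0, -1) U x)"

definition grad_F :: "real \<Rightarrow> (plane \<Rightarrow> real) \<Rightarrow> plane \<Rightarrow> plane" where
  "grad_F h U x = (1 / h) *\<^sub>R (fdiff h (1, 0) U x, fdiff h (0, 1) U x)"

definition grad_B :: "real \<Rightarrow> (plane \<Rightarrow> real) \<Rightarrow> plane \<Rightarrow> plane" where
  "grad_B h U x = (1 / h) *\<^sub>R (- fdiff h (-1, 0) U x, - fdiff h (0, -1) U x)"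

text \<open>Maximum of a nonnegative function over a finite set, with the convention that the maximum
  over the empty set is 0 (a compact set may contain no grid point).\<close>

definition max_on :: "'a set \<Rightarrow> ('a \<Rightarrow> real) \<Rightarrow> real" where
  "max_on A F = (if A = {} then 0 else Max (F ` A))"

end

theory Submission
  imports Defs "HOL-Complex_Analysis.Great_Picard"
begin

text \<open>
  The solutions turn out to be discretely convex: every second difference along an irreducible
  lattice direction is nonnegative. Outside \<open>X\<close> this is the boundary equation. Inside
  \<open>X\<close> the density is positive, and \<open>H_fun\<close> vanishes when one of its
  arguments does, so every second difference that occurs in an admissible superbase is positive;
  since unit steps from \<open>X\<close> stay in the square, each admissible direction occurs in
  one (\<open>superbase_completion\<close>, \<open>scheme_grid_convex\<close>). Following a
  lattice line to the boundary, where the support function of \<open>Y\<close> enters the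
  equation, yields the slope bounds \<open>scheme_slopes_bounded\<close>.

  The convex extension lies below the grid function at grid points.
  What has to be shown is that the two agree in the limit (\<open>grid_functions_converge\<close>).
  The slope bounds in the axis directions make the grid functions equi-Lipschitz, so a subsequence
  converges uniformly on the square to some \<open>w\<close>. Grid vectors approximate all
  vectors, hence \<open>w\<close> is midpoint convex, so convex, and the slope bounds place its
  subgradients in every polygon of the sequence, that is, in the closure of \<open>Y\<close>.
  These subgradients are admitted in the supremum that defines the convex extension, which forces
  \<open>v = w\<close> (\<open>convex_ext_limit_eq\<close>). Since the limit does not depend on
  the subsequence, the grid functions converge uniformly to \<open>v\<close>.

  Uniform convergence of functions that are convex along lattice lines implies convergence of
  difference quotients to the gradient of a \<open>C\<^sup>1\<close> limit: the quotient with step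
  \<open>h\<close> is at most the one with a fixed small step \<open>t\<close>, where the uniform
  error is negligible, and reversing the direction gives the lower bound
  (\<open>forward_quotient_le\<close>, \<open>quotient_converges\<close>).
\<close>

section \<open>Grid geometry\<close>

lemma of_zvec_simps [simp]:
  "fst (of_zvec e) = real_of_int (fst e)" "snd (of_zvec e) = real_of_int (snd e)"
  by (simp_all add: of_zvec_def)

lemma of_zvec_minus [simp]: "of_zvec (- e) = - of_zvec e"
  by (simp add: of_zvec_def)

lemma norm_le_abs_components: "norm x \<le> \<bar>fst x\<bar> + \<bar>snd x\<bar>" for x :: plane
  using norm_Pair_le[of "fst x" "snd x"] by simp

lemma mem_box_D: "x \<in> box_D \<longleftrightarrow> \<bar>fst x\<bar> \<le> 1 \<and> \<bar>snd x\<bar> \<le> 1"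
  by (cases x) (auto simp: box_D_def abs_le_iff)

lemma box_D_cbox: "box_D = cbox (-1, -1) (1, 1)"
  by (auto simp: box_D_def cbox_Pair_eq)

lemma convex_box_D: "convex box_D" and compact_box_D: "compact box_D"
  by (simp_all add: box_D_cbox)

lemma admissible_iff:
  assumes "h > 0"
  shows "admissible h x e \<longleftrightarrow>
    \<bar>fst x\<bar> + h * \<bar>real_of_int (fst e)\<bar> \<le> 1 \<and> \<bar>snd x\<bar> + h * \<bar>real_of_int (snd e)\<bar> \<le> 1"
proof -
  have *: "\<bar>a + b\<bar> \<le> 1 \<and> \<bar>a - b\<bar> \<le> 1 \<longleftrightarrow> \<bar>a\<bar> + \<bar>b\<bar> \<le> 1" for a b :: real
    by arith
  have "h * \<bar>real_of_int k\<bar> = \<bar>h * real_of_int k\<bar>" for k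
    using assms by (simp add: abs_mult)
  then show ?thesis
    unfolding admissible_def mem_box_D using *[of "fst x" "h * fst e"] *[of "snd x" "h * snd e"]
    by auto
qed

lemma finite_admissible:
  assumes "h > 0"
  shows "finite {e. admissible h x e}"
proof (rule finite_subset)
  show "{e. admissible h x e} \<subseteq> {-\<lfloor>1/h\<rfloor>..\<lfloor>1/h\<rfloor>} \<times> {-\<lfloor>1/h\<rfloor>..\<lfloor>1/h\<rfloor>}"
  proof
    fix e assume "e \<in> {e. admissible h x e}"
    moreover obtain a b where e: "e = (a, b)" by fastforce
    ultimately have "admissible h x (a, b)" by simp
    then have "h * \<bar>real_of_int a\<bar> \<le> 1" "h * \<bar>real_of_int b\<bar> \<le> 1"
      using assms by (auto simp: admissible_iff)
    then have "real_of_int \<bar>a\<bar> \<le> 1 / h" "real_of_int \<bar>b\<bar> \<le> 1 / h"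
      using assms by (simp_all add: field_simps)
    then have "\<bar>a\<bar> \<le> \<lfloor>1/h\<rfloor>" "\<bar>b\<bar> \<le> \<lfloor>1/h\<rfloor>"
      using le_floor_iff by blast+
    then show "e \<in> {-\<lfloor>1/h\<rfloor>..\<lfloor>1/h\<rfloor>} \<times> {-\<lfloor>1/h\<rfloor>..\<lfloor>1/h\<rfloor>}"
      by (auto simp: e)
  qed
qed simp

lemma finite_grid_box:
  assumes "h > 0"
  shows "finite (grid h \<inter> box_D)"
proof (rule finite_subset)
  show "grid h \<inter> box_D \<subseteq> (\<lambda>e. h *\<^sub>R of_zvec e) ` {e. admissible h 0 e}"
  proof
    fix x assume "x \<in> grid h \<inter> box_D"
    then obtain e where "x = h *\<^sub>R of_zvec e" "x \<in> box_D" by (auto simp: grid_def)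
    then show "x \<in> (\<lambda>e. h *\<^sub>R of_zvec e) ` {e. admissible h 0 e}"
      using assms by (auto simp: admissible_iff mem_box_D abs_mult)
  qed
qed (simp add: assms finite_admissible)

lemma grid_shift: "x \<in> grid h \<Longrightarrow> x + (real_of_int k * h) *\<^sub>R of_zvec e \<in> grid h"
proof -
  assume "x \<in> grid h"
  then obtain z where "x = h *\<^sub>R of_zvec z" by (auto simp: grid_def)
  then have "x + (real_of_int k * h) *\<^sub>R of_zvec e = h *\<^sub>R of_zvec (z + (k * fst e, k * snd e))"
    by (simp add: of_zvec_def algebra_simps)
  then show ?thesis unfolding grid_def by blast
qed

lemma grid_step: "x \<in> grid h \<Longrightarrow> x + h *\<^sub>R of_zvec e \<in> grid h"
  using grid_shift[of x h 1 e] by simp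

lemma zero_in_grid: "0 \<in> grid h"
  by (auto simp: grid_def image_iff of_zvec_def zero_prod_def intro!: exI[of _ 0])

lemma zero_in_box_D: "0 \<in> box_D"
  by (simp add: mem_box_D)

section \<open>Discrete convexity along lattice lines\<close>

definition grid_convex :: "real \<Rightarrow> (plane \<Rightarrow> real) \<Rightarrow> bool" where
  "grid_convex h U \<longleftrightarrow> (\<forall>x\<in>grid h \<inter> box_D. \<forall>e.
     irreducible_zvec e \<longrightarrow> admissible h x e \<longrightarrow> 0 \<le> sdiff h e U x)"

definition slopes_bounded :: "plane set \<Rightarrow> zvec set \<Rightarrow> real \<Rightarrow> (plane \<Rightarrow> real) \<Rightarrow> bool" where
  "slopes_bounded Y V h U \<longleftrightarrow> (\<forall>x\<in>grid h \<inter> box_D. \<forall>e\<in>V.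
     x + h *\<^sub>R of_zvec e \<in> box_D \<longrightarrow>
     U (x + h *\<^sub>R of_zvec e) - U x \<le> h * support_fun Y (of_zvec e))"

lemma convex_seq_mono:
  fixes a :: "nat \<Rightarrow> real"
  assumes "\<And>i. i + 2 \<le> m \<Longrightarrow> a (i+1) - a i \<le> a (i+2) - a (i+1)"
  shows "i \<le> j \<Longrightarrow> j < m \<Longrightarrow> a (i+1) - a i \<le> a (j+1) - a j"
proof (induction j)
  case (Suc j)
  show ?case
  proof (cases "i = Suc j")
    case False
    then have "a (i+1) - a i \<le> a (j+1) - a j" using Suc by simp
    also have "\<dots> \<le> a (j+2) - a (j+1)" using assms[of j] Suc by simp
    finally show ?thesis by simp
  qed simp
qed simp

lemma convex_seq_chord:
  fixes a :: "nat \<Rightarrow> real"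
  assumes "\<And>i. i + 2 \<le> m \<Longrightarrow> a (i+1) - a i \<le> a (i+2) - a (i+1)" "m > 0"
  shows "real m * (a 1 - a 0) \<le> a m - a 0"
proof -
  have "(\<Sum>i<m. a 1 - a 0) \<le> (\<Sum>i<m. a (Suc i) - a i)"
    using convex_seq_mono[where m=m and a=a and i=0] assms by (intro sum_mono) auto
  then show ?thesis by (simp add: sum_lessThan_telescope)
qed

lemma convex_seq_midpoint:
  fixes a :: "nat \<Rightarrow> real"
  assumes "\<And>i. i + 2 \<le> 2 * k \<Longrightarrow> a (i+1) - a i \<le> a (i+2) - a (i+1)"
  shows "2 * a k \<le> a 0 + a (2 * k)"
proof -
  have "(\<Sum>i<k. a (Suc i) - a i) \<le> (\<Sum>i<k. a (Suc (k + i)) - a (k + i))"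
    using convex_seq_mono[where m="2*k" and a=a] assms by (intro sum_mono) auto
  moreover have "(\<Sum>i<k. a (Suc (k + i)) - a (k + i)) = a (2 * k) - a k"
    using sum_lessThan_telescope[of "\<lambda>i. a (k + i)" k] by (simp add: mult_2)
  ultimately show ?thesis by (simp add: sum_lessThan_telescope)
qed

lemma box_D_segment:
  assumes "x \<in> box_D" "x + (real m * h) *\<^sub>R d \<in> box_D" "i \<le> m"
  shows "x + (real i * h) *\<^sub>R d \<in> box_D"
proof (cases "m = 0")
  case False
  have "(1 - real i / real m) *\<^sub>R x + (real i / real m) *\<^sub>R (x + (real m * h) *\<^sub>R d) \<in> box_D"
    using False assms(3) by (intro convexD[OF convex_box_D assms(1,2)]) auto
  also have "(1 - real i / real m) *\<^sub>R x + (real i / real m) *\<^sub>R (x + (real m * h) *\<^sub>R d) =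
      x + (real i * h) *\<^sub>R d"
    using False by (simp add: algebra_simps)
  finally show ?thesis .
qed (use assms in auto)

lemma grid_convex_line:
  assumes U: "grid_convex h U" and h: "h > 0" and x: "x \<in> grid h" "x \<in> box_D"
    and e: "irreducible_zvec e" and m: "x + (real m * h) *\<^sub>R of_zvec e \<in> box_D"
    and i: "i + 2 \<le> m"
  defines "a \<equiv> \<lambda>i. U (x + (real i * h) *\<^sub>R of_zvec e)"
  shows "a (i+1) - a i \<le> a (i+2) - a (i+1)"
proof -
  let ?z = "x + (real (i+1) * h) *\<^sub>R of_zvec e"
  have box: "x + (real j * h) *\<^sub>R of_zvec e \<in> box_D" if "j \<le> m" for j
    by (rule box_D_segment[OF x(2) m that])
  have zg: "?z \<in> grid h" using grid_shift[OF x(1), of "int (i+1)" e] by simp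
  have zb: "?z \<in> box_D" using i by (intro box) simp
  have nbr: "?z + h *\<^sub>R of_zvec e = x + (real (i+2) * h) *\<^sub>R of_zvec e"
    "?z - h *\<^sub>R of_zvec e = x + (real i * h) *\<^sub>R of_zvec e"
    by (simp_all add: prod_eq_iff algebra_simps)
  have "admissible h ?z e"
    unfolding admissible_def nbr using i by (intro conjI box) auto
  then have "0 \<le> sdiff h e U ?z"
    using U[unfolded grid_convex_def, rule_format, OF IntI[OF zg zb] e] by blast
  also have "sdiff h e U ?z = a (i+2) - a (i+1) + (a i - a (i+1))"
    unfolding sdiff_def fdiff_def of_zvec_minus a_def nbr(1)[symmetric] nbr(2)[symmetric]
    by simp
  finally show ?thesis by simp
qed

lemma grid_convex_chord:
  assumes "grid_convex h U" "h > 0" "x \<in> grid h" "x \<in> box_D" "irreducible_zvec e"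
    and "x + (real m * h) *\<^sub>R of_zvec e \<in> box_D" "m > 0"
  shows "real m * (U (x + h *\<^sub>R of_zvec e) - U x) \<le> U (x + (real m * h) *\<^sub>R of_zvec e) - U x"
  using convex_seq_chord[where a="\<lambda>i. U (x + (real i * h) *\<^sub>R of_zvec e)" and m=m,
      OF grid_convex_line[OF assms(1-6)]] assms(7) by simp

lemma irreducible_direction:
  assumes "z \<noteq> 0"
  obtains k e where "irreducible_zvec e" "k > (0::nat)" "of_zvec z = real k *\<^sub>R of_zvec e"
proof -
  obtain a b where z: "z = (a, b)" by fastforce
  then have "gcd a b \<noteq> 0" using assms by (auto simp: zero_prod_def)
  then obtain a' b' where *: "a = a' * gcd a b" "b = b' * gcd a b" "coprime a' b'"
    by (metis gcd_coprime_exists)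
  define k where "k = nat (gcd a b)"
  have k: "k > 0" "gcd a b = int k" using \<open>gcd a b \<noteq> 0\<close> by (auto simp: k_def)
  have "real_of_int a = real_of_int (a' * int k)" "real_of_int b = real_of_int (b' * int k)"
    using * k(2) by simp_all
  then show ?thesis
    using that[of "(a', b')" k] *(3) k(1)
    by (simp add: z irreducible_zvec_def of_zvec_def mult.commute)
qed

text \<open>Every lattice vector is a multiple \<open>k e\<close> of an irreducible \<open>e\<close>, and the \<open>2 k\<close> increments
  along the lattice line through \<open>x\<close> are nondecreasing. Having this for all vectors is what makes
  arbitrary pairs of points accessible when the grid is refined.\<close>

lemma grid_convex_midpoint:
  assumes U: "grid_convex h U" and h: "h > 0" and x: "x \<in> grid h"
    and adm: "x + h *\<^sub>R of_zvec z \<in> box_D" "x - h *\<^sub>R of_zvec z \<in> box_D"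
  shows "2 * U x \<le> U (x + h *\<^sub>R of_zvec z) + U (x - h *\<^sub>R of_zvec z)"
proof (cases "z = 0")
  case True
  then show ?thesis by (simp add: of_zvec_def flip: zero_prod_def)
next
  case False
  then obtain k e where e: "irreducible_zvec e" "k > (0::nat)" "of_zvec z = real k *\<^sub>R of_zvec e"
    using irreducible_direction by blast
  define y where "y = x - (real k * h) *\<^sub>R of_zvec e"
  have y: "y = x - h *\<^sub>R of_zvec z" by (simp add: y_def e(3) mult.commute)
  have "y \<in> grid h" using grid_shift[OF x, of "- int k" e] by (simp add: y_def)
  moreover have ybox: "y \<in> box_D" using adm y by simp
  have top: "y + (real (2 * k) * h) *\<^sub>R of_zvec e = x + h *\<^sub>R of_zvec z"
    by (simp add: y_def e(3) prod_eq_iff algebra_simps)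
  have mid: "y + (real k * h) *\<^sub>R of_zvec e = x" by (simp add: y_def)
  moreover have "y + (real (2 * k) * h) *\<^sub>R of_zvec e \<in> box_D" using adm top by simp
  ultimately have "2 * U (y + (real k * h) *\<^sub>R of_zvec e) \<le>
      U (y + (real 0 * h) *\<^sub>R of_zvec e) + U (y + (real (2 * k) * h) *\<^sub>R of_zvec e)"
    by (intro convex_seq_midpoint grid_convex_line[OF U h _ ybox e(1), where m="2 * k"])
  then show ?thesis unfolding top mid using y by simp
qed

section \<open>Superbases\<close>

lemma bezout_in_box:
  fixes a b :: int
  assumes "coprime a b" "a > 0" "b > 0"
  obtains c d where "0 \<le> c" "c \<le> a" "0 \<le> d" "d \<le> b" "a * d - b * c = 1"
proof -
  obtain u w where uw: "u * a + w * b = 1"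
    using bezout_int[of a b] assms(1) by (auto simp: coprime_iff_gcd_eq_1)
  \<comment> \<open>Reducing the first coordinate modulo \<open>a\<close> forces the second one into \<open>{0..b}\<close>.\<close>
  define c where "c = (- w) mod a"
  define d where "d = u + b * ((w + c) div a)"
  have c: "0 \<le> c" "c < a" using assms by (simp_all add: c_def)
  have "a dvd w + c" unfolding c_def
    by (metis add.commute add.right_inverse dvd_eq_mod_eq_0 mod_0 mod_add_left_eq)
  then have "a * ((w + c) div a) = w + c" by simp
  then have "b * (a * ((w + c) div a)) = b * (w + c)" by simp
  then have "a * d = u * a + b * (w + c)" by (simp add: d_def algebra_simps)
  then have det: "a * d - b * c = 1" using uw by (simp add: algebra_simps)
  have "b * c \<ge> 0" using c assms by simp
  then have "a * d > 0" using det by simp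
  then have "d > 0" using assms by (simp add: zero_less_mult_iff)
  moreover have "b * c \<le> b * (a - 1)" using c assms by simp
  then have "a * d \<le> a * b" using det assms by (simp add: algebra_simps)
  then have "d \<le> b" using assms by simp
  ultimately show ?thesis using that[of c d] c det by simp
qed

text \<open>Splitting \<open>e\<close> into its two Stern-Brocot parents gives a superbase whose members stay in
  the coordinate box spanned by \<open>e\<close>, up to unit steps; so they do not leave the square sooner than
  \<open>e\<close> does.\<close>

lemma superbase_completion:
  assumes "irreducible_zvec e"
  obtains e' e'' where "superbase (e, e', e'')"
    "\<bar>fst e'\<bar> \<le> max \<bar>fst e\<bar> 1" "\<bar>snd e'\<bar> \<le> max \<bar>snd e\<bar> 1"
    "\<bar>fst e''\<bar> \<le> max \<bar>fst e\<bar> 1" "\<bar>snd e''\<bar> \<le> max \<bar>snd e\<bar> 1"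
proof -
  obtain a b where e: "e = (a, b)" by fastforce
  have co: "coprime a b" using assms by (simp add: e irreducible_zvec_def)
  have "\<exists>c d. \<bar>a * d - b * c\<bar> = 1 \<and> \<bar>c\<bar> \<le> max \<bar>a\<bar> 1 \<and> \<bar>d\<bar> \<le> max \<bar>b\<bar> 1 \<and>
      \<bar>a - c\<bar> \<le> max \<bar>a\<bar> 1 \<and> \<bar>b - d\<bar> \<le> max \<bar>b\<bar> 1"
  proof (cases "a = 0 \<or> b = 0")
    case True
    then show ?thesis
    proof
      assume "a = 0"
      then show ?thesis using co by (intro exI[of _ 1] exI[of _ 0]) auto
    next
      assume "b = 0"
      then show ?thesis using co by (intro exI[of _ 0] exI[of _ 1]) auto
    qed
  next
    case False
    then obtain c d where cd: "0 \<le> c" "c \<le> \<bar>a\<bar>" "0 \<le> d" "d \<le> \<bar>b\<bar>" "\<bar>a\<bar> * d - \<bar>b\<bar> * c = 1"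
      using bezout_in_box[of "\<bar>a\<bar>" "\<bar>b\<bar>"] co by auto
    have "a * (sgn b * d) - b * (sgn a * c) = sgn a * sgn b * (\<bar>a\<bar> * d - \<bar>b\<bar> * c)"
      using False by (auto simp: sgn_if algebra_simps)
    then have "\<bar>a * (sgn b * d) - b * (sgn a * c)\<bar> = 1"
      using cd(5) False by (simp add: abs_mult sgn_if)
    moreover have "\<bar>sgn a * c\<bar> \<le> \<bar>a\<bar>" "\<bar>a - sgn a * c\<bar> \<le> \<bar>a\<bar>"
      "\<bar>sgn b * d\<bar> \<le> \<bar>b\<bar>" "\<bar>b - sgn b * d\<bar> \<le> \<bar>b\<bar>"
      using cd by (auto simp: sgn_if)
    ultimately show ?thesis by (meson max.coboundedI1)
  qed
  then obtain c d where cd: "\<bar>a * d - b * c\<bar> = 1" "\<bar>c\<bar> \<le> max \<bar>a\<bar> 1" "\<bar>d\<bar> \<le> max \<bar>b\<bar> 1"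
      "\<bar>a - c\<bar> \<le> max \<bar>a\<bar> 1" "\<bar>b - d\<bar> \<le> max \<bar>b\<bar> 1" by blast
  have "(- c) * (d - b) - (- d) * (c - a) = - (a * d - b * c)" by (simp add: algebra_simps)
  then have "\<bar>(- c) * (d - b) - (- d) * (c - a)\<bar> = 1" using cd(1) by simp
  then have "superbase (e, (- c, - d), (c - a, d - b))"
    by (simp add: superbase_def e zero_prod_def)
  then show ?thesis
    using that[of "(- c, - d)" "(c - a, d - b)"] cd by (simp add: e abs_minus_commute)
qed

lemma H_fun_zero: "b \<ge> 0 \<Longrightarrow> c \<ge> 0 \<Longrightarrow> H_fun 0 b c = 0"
  by (auto simp: H_fun_def)

text \<open>\<open>H_fun\<close> vanishes as soon as one of its arguments does, so a positive value of the minimum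
  forces every second difference that enters it to be positive.\<close>

lemma MA_pos_imp_sdiff_pos:
  assumes h: "h > 0" and pos: "MA h U x > 0" and e: "irreducible_zvec e" "admissible h x e"
    and unit: "admissible h x (1, 0)" "admissible h x (0, 1)"
  shows "sdiff h e U x > 0"
proof (rule ccontr)
  assume neg: "\<not> sdiff h e U x > 0"
  let ?S = "{(e, e', e''). superbase (e, e', e'') \<and>
          admissible h x e \<and> admissible h x e' \<and> admissible h x e''}"
  let ?F = "\<lambda>(e, e', e''). H_fun (sdiff_pos h e U x) (sdiff_pos h e' U x) (sdiff_pos h e'' U x)"
  obtain e' e'' where b: "superbase (e, e', e'')"
    "\<bar>fst e'\<bar> \<le> max \<bar>fst e\<bar> 1" "\<bar>snd e'\<bar> \<le> max \<bar>snd e\<bar> 1"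
    "\<bar>fst e''\<bar> \<le> max \<bar>fst e\<bar> 1" "\<bar>snd e''\<bar> \<le> max \<bar>snd e\<bar> 1"
    using superbase_completion[OF e(1)] by blast
  have mono: "t + h * \<bar>real_of_int k'\<bar> \<le> 1"
    if "\<bar>k'\<bar> \<le> max \<bar>k\<bar> 1" "t + h * \<bar>real_of_int k\<bar> \<le> 1" "t + h \<le> 1" for t k k'
  proof -
    have "real_of_int \<bar>k'\<bar> \<le> real_of_int (max \<bar>k\<bar> 1)" using that(1) by linarith
    then have "h * \<bar>real_of_int k'\<bar> \<le> h * max \<bar>real_of_int k\<bar> 1"
      using h by (intro mult_left_mono) auto
    then show ?thesis using that by (auto simp: max_def split: if_splits)
  qed
  have "admissible h x e'" "admissible h x e''"
    using b(2-) e(2) unit unfolding admissible_iff[OF h] by (auto intro: mono)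
  then have "(e, e', e'') \<in> ?S" using b(1) e(2) by simp
  moreover have "finite ?S"
    by (rule finite_subset[OF _ finite_cartesian_product[OF finite_admissible[OF h, of x]
            finite_cartesian_product[OF finite_admissible[OF h, of x] finite_admissible[OF h, of x]]]]) auto
  ultimately have "Min (?F ` ?S) \<le> ?F (e, e', e'')"
    by (intro Min_le imageI finite_imageI)
  also have "\<dots> = 0"
    using neg by (simp add: sdiff_pos_def max_def H_fun_zero)
  finally have "MA h U x \<le> 0"
    unfolding MA_def using h by (intro mult_nonneg_nonpos) auto
  then show False using pos by simp
qed

section \<open>Properties of solutions of the scheme\<close>

lemma integrable_lebesgue_shift:
  fixes f :: "plane \<Rightarrow> real"
  assumes "integrable lebesgue f"
  shows "integrable lebesgue (\<lambda>t. f (x + t))"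
proof -
  let ?T = "\<lambda>t::plane. x + t"
  have T: "(\<lambda>t. x + (\<Sum>j\<in>Basis. (1 * (t \<bullet> j)) *\<^sub>R j)) = ?T"
    by (simp add: euclidean_representation)
  have "?T \<in> lebesgue \<rightarrow>\<^sub>M lebesgue"
    using lebesgue_affine_measurable[of "\<lambda>_. 1" x] unfolding T by simp
  moreover have "(lebesgue :: plane measure) = density (distr lebesgue lebesgue ?T) (\<lambda>_. 1)"
    using lebesgue_affine_euclidean[of "\<lambda>_. 1" x] unfolding T by simp
  then have "(lebesgue :: plane measure) = distr lebesgue lebesgue ?T"
    by (simp add: density_1)
  ultimately show ?thesis
    using assms integrable_distr[of ?T lebesgue lebesgue f] by simp
qed

text \<open>A small square around \<open>x\<close> lies in both \<open>X\<close> and the cell, and \<open>f\<close> is at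
  least \<open>mf\<close> there.\<close>

lemma cell_average_pos:
  assumes "open X" "x \<in> X" "h > 0" "integrable lebesgue f" "0 < mf"
    and "\<And>x. x \<notin> X \<Longrightarrow> f x = 0" "\<And>x. x \<in> X \<Longrightarrow> mf \<le> f x"
  shows "cell_average f h x > 0"
proof -
  let ?Q = "{-h/2..h/2} \<times> {-h/2..h/2} :: plane set"
  obtain d where d: "d > 0" "ball x d \<subseteq> X" using assms(1,2) open_contains_ball by blast
  define s where "s = min (h/2) (d/4)"
  have s: "s > 0" "s \<le> h/2" "s \<le> d/4" using assms d by (auto simp: s_def)
  let ?B = "cbox (-s, -s) (s, s) :: plane set"
  have BQ: "?B \<subseteq> ?Q" using s by (auto simp: cbox_Pair_eq)
  have BX: "x + t \<in> X" if "t \<in> ?B" for t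
  proof -
    have "norm t \<le> \<bar>fst t\<bar> + \<bar>snd t\<bar>" by (rule norm_le_abs_components)
    also have "\<dots> \<le> s + s" using that by (auto simp: cbox_Pair_eq)
    also have "\<dots> < d" using s d(1) by simp
    finally show ?thesis using d(2) by (auto simp: dist_norm)
  qed
  have Q: "?Q = cbox (-h/2, -h/2) (h/2, h/2)" by (simp add: cbox_Pair_eq)
  have nonneg: "0 \<le> f y" for y
    using assms(5) assms(6)[of y] assms(7)[of y] by (cases "y \<in> X") auto
  have "0 < measure lborel ?B"
    using s(1) by (intro content_pos_lt) (auto simp: Basis_prod_def)
  then have "0 < mf * measure lebesgue ?B"
    using assms(5) by simp
  also have "\<dots> = (LINT t:?B|lebesgue. mf)"
    unfolding set_lebesgue_integral_def by simp
  also have "\<dots> \<le> (LINT t:?Q|lebesgue. f (x + t))"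
    unfolding set_lebesgue_integral_def
  proof (rule integral_mono)
    show "integrable lebesgue (\<lambda>t. indicat_real ?B t *\<^sub>R mf)"
      using emeasure_lborel_cbox_finite[of "(-s, -s)" "(s, s)"]
      by (intro integrable_scaleR_left integrable_real_indicator) auto
    show "integrable lebesgue (\<lambda>t. indicat_real ?Q t *\<^sub>R f (x + t))"
      using integrable_lebesgue_shift[OF assms(4)] unfolding Q
      by (intro integrable_mult_indicator) auto
    show "indicat_real ?B t *\<^sub>R mf \<le> indicat_real ?Q t *\<^sub>R f (x + t)" for t
      using BQ BX assms(7) nonneg by (auto simp: indicator_def)
  qed
  finally show ?thesis using assms(3) by (simp add: cell_average_def)
qed

lemma bdd_above_support:
  assumes "bounded Y"
  shows "bdd_above ((\<lambda>y. y \<bullet> z) ` closure Y)"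
  using assms by (intro bounded_imp_bdd_above bounded_linear_image[OF _ bounded_linear_inner_left]) auto

lemma support_fun_upper: "bounded Y \<Longrightarrow> y \<in> closure Y \<Longrightarrow> y \<bullet> z \<le> support_fun Y z"
  unfolding support_fun_def by (rule cSUP_upper[OF _ bdd_above_support])

lemma support_fun_scale:
  assumes "Y \<noteq> {}" "bounded Y" "h > 0"
  shows "support_fun Y (h *\<^sub>R z) \<le> h * support_fun Y z"
  unfolding support_fun_def[of Y "h *\<^sub>R z"]
  using assms support_fun_upper[OF assms(2)] by (intro cSUP_least) auto

text \<open>The inclusion assumption on \<open>V\<close> keeps unit steps from \<open>X\<close> in the square; without them the
  superbases available at a point of \<open>X\<close> might miss some directions.\<close>

lemma scheme_grid_convex:
  assumes U: "solves_scheme X Y f g V G h U" and h: "h > 0"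
    and X: "open X" and f: "integrable lebesgue f" "0 < mf"
      "\<And>x. x \<notin> X \<Longrightarrow> f x = 0" "\<And>x. x \<in> X \<Longrightarrow> mf \<le> f x"
    and g: "\<And>y. 0 < g y"
    and V: "finite V" "{(1, 0), (-1, 0), (0, 1), (0, -1)} \<subseteq> V"
      "\<And>x e. x \<in> X \<Longrightarrow> e \<in> V \<Longrightarrow> x + h *\<^sub>R of_zvec e \<in> box_D"
  shows "grid_convex h U"
  unfolding grid_convex_def
proof (intro ballI allI impI)
  fix x e assume x: "x \<in> grid h \<inter> box_D" and e: "irreducible_zvec e" "admissible h x e"
  show "0 \<le> sdiff h e U x"
  proof (cases "x \<in> X")
    case True
    have "MA h U x = cell_average f h x / g (G U x)"
      using U True x by (simp add: solves_scheme_def)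
    also have "\<dots> > 0" using cell_average_pos[OF X True h f] g by simp
    finally have pos: "MA h U x > 0" .
    have "admissible h x (1, 0)" "admissible h x (0, 1)"
      using V(3)[OF True, of "(1,0)"] V(3)[OF True, of "(-1,0)"] V(3)[OF True, of "(0,1)"]
        V(3)[OF True, of "(0,-1)"] V(2)
      by (auto simp: admissible_iff[OF h] mem_box_D)
    then show ?thesis using MA_pos_imp_sdiff_pos[OF h pos e] by simp
  next
    case False
    have "0 = MA0_bd Y V h U x" using U False x by (simp add: solves_scheme_def)
    also have "\<dots> \<le> sdiff_bd Y h e U x"
      unfolding MA0_bd_def using e V(1) finite_subset[OF _ finite_admissible[OF h, of x]]
      by (intro Min_le finite_imageI finite_UnI) auto
    also have "\<dots> = sdiff h e U x"
      using e(2) by (simp add: sdiff_bd_def sdiff_def fdiff_bd_def fdiff_def admissible_def)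
    finally show ?thesis .
  qed
qed

text \<open>Increments do not decrease along a lattice line.  The line leaves the square from a point
  \<open>z\<close> outside \<open>X\<close>, since steps in \<open>V\<close> from \<open>X\<close> remain in the square; there the boundary operator bounds
  the last increment by the support function of \<open>Y\<close>.\<close>

lemma scheme_slopes_bounded:
  assumes U: "solves_scheme X Y f g V G h U" and h: "h > 0" and conv: "grid_convex h U"
    and Y: "Y \<noteq> {}" "bounded Y"
    and V: "finite V" "\<And>e. e \<in> V \<Longrightarrow> irreducible_zvec e"
      "\<And>x e. x \<in> X \<Longrightarrow> e \<in> V \<Longrightarrow> x + h *\<^sub>R of_zvec e \<in> box_D"
  shows "slopes_bounded Y V h U"
  unfolding slopes_bounded_def
proof (intro ballI impI)
  fix x e assume x: "x \<in> grid h \<inter> box_D" and e: "e \<in> V" and xe: "x + h *\<^sub>R of_zvec e \<in> box_D"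
  define P where "P = (\<lambda>i::nat. x + (real i * h) *\<^sub>R of_zvec e)"
  have irr: "irreducible_zvec e" using V(2) e by blast
  then have "e \<noteq> 0" by (auto simp: irreducible_zvec_def)
  have P_grid: "P i \<in> grid h" for i
    using grid_shift[of x h "int i" e] x by (simp add: P_def)
  have P_Suc: "P (Suc i) = P i + h *\<^sub>R of_zvec e" for i
    by (simp add: P_def prod_eq_iff algebra_simps)
  have "inj P"
    using h \<open>e \<noteq> 0\<close> by (auto simp: inj_def P_def prod_eq_iff)
  have "\<exists>i. P i \<notin> box_D"
  proof (rule ccontr)
    assume "\<nexists>i. P i \<notin> box_D"
    then have "range P \<subseteq> grid h \<inter> box_D" using P_grid by blast
    then show False
      using finite_grid_box[OF h] \<open>inj P\<close> finite_subset range_inj_infinite by blast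
  qed
  \<comment> \<open>\<open>P n\<close> is the first point of the line outside the square; the boundary equation is used at
    its predecessor.\<close>
  then obtain n where n: "P n \<notin> box_D" "\<And>i. i < n \<Longrightarrow> P i \<in> box_D"
    using exists_least_iff[of "\<lambda>i. P i \<notin> box_D"] by blast
  have "P 0 = x" "P 1 = x + h *\<^sub>R of_zvec e" by (simp_all add: P_def)
  then have "n \<noteq> 0" "n \<noteq> 1" using n(1) x xe by (metis IntD2, metis)
  then obtain k where k: "n = Suc (Suc k)" by (metis One_nat_def not0_implies_Suc)
  define z where "z = P (Suc k)"
  have z: "z \<in> grid h" "z \<in> box_D" "z + h *\<^sub>R of_zvec e \<notin> box_D" "z - h *\<^sub>R of_zvec e = P k"
    using n(2)[of "Suc k"] n(1) k P_grid[of "Suc k"] by (simp_all add: z_def P_Suc)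
  then have "z \<notin> X" using V(3) e by blast
  then have "0 = MA0_bd Y V h U z" using U z by (simp add: solves_scheme_def)
  also have "\<dots> \<le> sdiff_bd Y h e U z"
    unfolding MA0_bd_def using e V(1) finite_subset[OF _ finite_admissible[OF h, of z]]
    by (intro Min_le finite_imageI finite_UnI) auto
  also have "\<dots> = support_fun Y (h *\<^sub>R of_zvec e) + U (P k) - U z"
    using z n k by (simp add: sdiff_bd_def fdiff_bd_def)
  finally have "U (P (Suc k)) - U (P k) \<le> h * support_fun Y (of_zvec e)"
    using support_fun_scale[OF Y h, of "of_zvec e"] by (simp add: z_def)
  moreover have "U (P (0+1)) - U (P 0) \<le> U (P (k+1)) - U (P k)"
  proof (rule convex_seq_mono[where m="Suc k" and a="\<lambda>i. U (P i)"])
    show "U (P (i+1)) - U (P i) \<le> U (P (i+2)) - U (P (i+1))" if "i + 2 \<le> Suc k" for i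
      using grid_convex_line[OF conv h _ _ irr _ that, of x] x n(2)[of "Suc k"] k
      by (simp add: P_def)
  qed auto
  ultimately show "U (x + h *\<^sub>R of_zvec e) - U x \<le> h * support_fun Y (of_zvec e)"
    by (simp add: P_def)
qed

section \<open>Convex functions\<close>

text \<open>A failure of convexity on a segment produces a positive maximum of the function minus its
  chord, in the interior of the segment.\<close>

lemma midpoint_convex_imp_convex_on:
  fixes f :: "'a::real_normed_vector \<Rightarrow> real"
  assumes cont: "continuous_on S f" and S: "convex S"
    and mid: "\<And>x y. x \<in> S \<Longrightarrow> y \<in> S \<Longrightarrow> 2 * f ((1/2) *\<^sub>R (x + y)) \<le> f x + f y"
  shows "convex_on S f"
proof (rule convex_onI[OF _ S], rule ccontr)
  fix t x y assume t: "0 < (t::real)" "t < 1" and xy: "x \<in> S" "y \<in> S"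
    and neg: "\<not> f ((1 - t) *\<^sub>R x + t *\<^sub>R y) \<le> (1 - t) * f x + t * f y"
  define p where "p = (\<lambda>s. (1 - s) *\<^sub>R x + s *\<^sub>R y)"
  define g where "g = (\<lambda>s. f (p s) - ((1 - s) * f x + s * f y))"
  have pS: "p s \<in> S" if "s \<in> {0..1}" for s
    using convexD_alt[OF S xy, of s] that by (simp add: p_def)
  have g_cont: "continuous_on {0..1} g"
    unfolding g_def
    by (intro continuous_intros continuous_on_compose2[OF cont]) (auto simp: p_def intro!: continuous_intros pS[unfolded p_def])
  obtain s1 where s1: "s1 \<in> {0..1}" "\<And>s. s \<in> {0..1} \<Longrightarrow> g s \<le> g s1"
    using continuous_attains_sup[OF compact_Icc _ g_cont] by auto
  define T where "T = {s \<in> {0..1}. g s = g s1}"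
  have "compact T"
  proof -
    have "closed T" unfolding T_def
      by (rule continuous_closed_preimage_constant[OF g_cont]) simp
    moreover have "bounded T" by (rule bounded_subset[of "{0..1}"]) (auto simp: T_def)
    ultimately show ?thesis by (simp add: compact_eq_bounded_closed)
  qed
  \<comment> \<open>At the leftmost maximum point the midpoint inequality is violated.\<close>
  then obtain s0 where s0: "s0 \<in> T" "\<And>s. s \<in> T \<Longrightarrow> s0 \<le> s"
    using compact_attains_inf[of T] s1(1) by (auto simp: T_def)
  have "g t > 0" using neg by (simp add: g_def p_def)
  then have "g s0 > 0" using s0(1) s1(2)[of t] t by (simp add: T_def)
  moreover have "g 0 = 0" "g 1 = 0" by (simp_all add: g_def p_def)
  ultimately have "s0 \<noteq> 0" "s0 \<noteq> 1" by auto
  then have s01: "0 < s0" "s0 < 1" using s0(1) by (auto simp: T_def)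
  define d where "d = min s0 (1 - s0)"
  have d: "d > 0" "s0 - d \<in> {0..1}" "s0 + d \<in> {0..1}" using s01 by (auto simp: d_def)
  have "(1/2) *\<^sub>R (p (s0 - d) + p (s0 + d)) = (1/2) *\<^sub>R (2 *\<^sub>R p s0)"
    unfolding p_def scaleR_2 by (simp add: algebra_simps)
  then have "(1/2) *\<^sub>R (p (s0 - d) + p (s0 + d)) = p s0" by simp
  then have "2 * f (p s0) \<le> f (p (s0 - d)) + f (p (s0 + d))"
    using mid[OF pS[OF d(2)] pS[OF d(3)]] by simp
  then have "2 * g s0 \<le> g (s0 - d) + g (s0 + d)"
    by (simp add: g_def algebra_simps)
  moreover have "g (s0 - d) < g s1"
    using s1(2)[OF d(2)] s0(2)[of "s0 - d"] d by (auto simp: T_def order.strict_iff_order)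
  moreover have "g (s0 + d) \<le> g s1" by (rule s1(2)[OF d(3)])
  ultimately show False using s0(1) by (simp add: T_def)
qed

text \<open>A hyperplane separates the epigraph from the open vertical ray below the graph at \<open>x\<close>; it is
  not vertical because \<open>x\<close> is an interior point of \<open>S\<close>.\<close>

lemma convex_on_subgradient:
  fixes f :: "'a::euclidean_space \<Rightarrow> real"
  assumes f: "convex_on S f" and S: "open S" and x: "x \<in> S"
  obtains y where "\<And>z. z \<in> S \<Longrightarrow> f x + y \<bullet> (z - x) \<le> f z"
proof -
  have "convex ({x} \<times> {..<f x})" by (intro convex_Times) auto
  moreover have "convex (epigraph S f)" by (rule convex_epigraphI[OF f])
  moreover have "{x} \<times> {..<f x} \<noteq> {}" "epigraph S f \<noteq> {}"
    using x by (auto simp: epigraph_def intro: exI[of _ "f x - 1"])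
  moreover have "({x} \<times> {..<f x}) \<inter> epigraph S f = {}" by (auto simp: epigraph_def)
  ultimately obtain a b where a: "a \<noteq> 0" "\<And>u. u \<in> {x} \<times> {..<f x} \<Longrightarrow> a \<bullet> u \<le> b"
      "\<And>u. u \<in> epigraph S f \<Longrightarrow> b \<le> a \<bullet> u"
    using separating_hyperplane_sets by metis
  obtain p q where pq: "a = (p, q)" by fastforce
  have below: "p \<bullet> x + q * (f x - e) \<le> b" if "e > 0" for e
    using a(2)[of "(x, f x - e)"] that by (simp add: pq)
  have above: "b \<le> p \<bullet> z + q * f z" if "z \<in> S" for z
    using a(3)[of "(z, f z)"] that by (simp add: pq epigraph_def)
  have "q \<ge> 0" using below[of 1] above[OF x] by (simp add: algebra_simps)
  moreover have "q \<noteq> 0"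
  proof
    assume q: "q = 0"
    then have "p \<noteq> 0" using a(1) pq by (simp add: zero_prod_def)
    obtain r where r: "r > 0" "ball x r \<subseteq> S" using S x open_contains_ball by blast
    define z where "z = x - (r / (2 * norm p)) *\<^sub>R p"
    have "dist x z < r" using r \<open>p \<noteq> 0\<close> by (simp add: z_def dist_norm)
    then have "z \<in> S" using r by auto
    then have "p \<bullet> x \<le> p \<bullet> z" using below[of 1] above[of z] q by simp
    then have "(r / (2 * norm p)) * (p \<bullet> p) \<le> 0" by (simp add: z_def inner_diff_right)
    moreover have "(r / (2 * norm p)) * (p \<bullet> p) > 0" using r \<open>p \<noteq> 0\<close> by simp
    ultimately show False by simp
  qed
  ultimately have q: "q > 0" by simp
  have "f x + (- (1 / q) *\<^sub>R p) \<bullet> (z - x) \<le> f z" if z: "z \<in> S" for z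
  proof -
    have "q * f x \<le> p \<bullet> (z - x) + q * f z"
    proof (rule field_le_epsilon)
      fix e :: real assume "e > 0"
      then have "p \<bullet> x + q * (f x - e / q) \<le> p \<bullet> z + q * f z"
        using below[of "e / q"] above[OF z] q by simp
      then show "q * f x \<le> p \<bullet> (z - x) + q * f z + e"
        using q by (simp add: inner_diff_right algebra_simps)
    qed
    then show ?thesis using q by (simp add: field_simps)
  qed
  then show ?thesis using that by blast
qed

text \<open>The McShane extension. It turns functions on varying grids into functions on one domain, so
  that the Arzela-Ascoli theorem applies.\<close>

lemma finite_lipschitz_extension:
  fixes f :: "'a::metric_space \<Rightarrow> real"
  assumes A: "finite A" "A \<noteq> {}" and L: "L \<ge> 0"
    and lip: "\<And>x y. x \<in> A \<Longrightarrow> y \<in> A \<Longrightarrow> f x - f y \<le> L * dist x y"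
  obtains F where "\<And>x. x \<in> A \<Longrightarrow> F x = f x" "\<And>x y. \<bar>F x - F y\<bar> \<le> L * dist x y"
proof -
  define F where "F = (\<lambda>x. Min ((\<lambda>z. f z + L * dist x z) ` A))"
  have le: "F x \<le> f z + L * dist x z" if "z \<in> A" for x z
    unfolding F_def using A that by (intro Min_le) auto
  have ge: "c \<le> F x" if "\<And>z. z \<in> A \<Longrightarrow> c \<le> f z + L * dist x z" for c x
    unfolding F_def using A that by (subst Min_ge_iff) auto
  have "F x = f x" if "x \<in> A" for x
  proof (rule antisym)
    show "F x \<le> f x" using le[OF that, of x] by simp
    show "f x \<le> F x" using lip[OF that] by (intro ge) (simp add: algebra_simps)
  qed
  moreover have half: "F x - F y \<le> L * dist x y" for x y
  proof -
    have "F x - L * dist x y \<le> F y"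
    proof (rule ge)
      fix z assume z: "z \<in> A"
      have "L * dist x z \<le> L * (dist x y + dist y z)"
        by (intro mult_left_mono dist_triangle L)
      then show "F x - L * dist x y \<le> f z + L * dist y z"
        using le[OF z, of x] by (simp add: algebra_simps)
    qed
    then show ?thesis by simp
  qed
  moreover have "\<bar>F x - F y\<bar> \<le> L * dist x y" for x y
    using half[of x y] half[of y x] by (simp add: dist_commute abs_le_iff)
  ultimately show ?thesis using that by blast
qed

section \<open>Equi-Lipschitz bounds and the convex extension\<close>

lemma slopes_bounded_line:
  assumes S: "slopes_bounded Y V h U" and e: "e \<in> V" and x: "x \<in> grid h" "x \<in> box_D"
  shows "x + (real m * h) *\<^sub>R of_zvec e \<in> box_D \<Longrightarrow>
    U (x + (real m * h) *\<^sub>R of_zvec e) - U x \<le> real m * (h * support_fun Y (of_zvec e))"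
proof (induction m)
  case (Suc m)
  let ?z = "x + (real m * h) *\<^sub>R of_zvec e"
  have z: "?z \<in> box_D" using box_D_segment[OF x(2) Suc.prems, of m] by simp
  have Suc_z: "x + (real (Suc m) * h) *\<^sub>R of_zvec e = ?z + h *\<^sub>R of_zvec e"
    by (simp add: prod_eq_iff algebra_simps)
  have "?z \<in> grid h" using grid_shift[OF x(1), of "int m" e] by simp
  then have "U (?z + h *\<^sub>R of_zvec e) - U ?z \<le> h * support_fun Y (of_zvec e)"
    using S[unfolded slopes_bounded_def, rule_format, of ?z e] z e Suc.prems unfolding Suc_z
    by blast
  then show ?case unfolding Suc_z using Suc.IH[OF z] by (simp add: algebra_simps)
qed simp

text \<open>The factor \<open>2\<close> comes from joining \<open>x\<close> and \<open>y\<close> by a horizontal and a vertical lattice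
  segment; the corner stays in the square because the square is a product of intervals.\<close>

lemma slopes_bounded_lipschitz:
  assumes S: "slopes_bounded Y V h U" and h: "h > 0"
    and V: "{(1, 0), (-1, 0), (0, 1), (0, -1)} \<subseteq> V"
    and C: "C \<ge> 0" "\<And>e. e \<in> {(1, 0), (-1, 0), (0, 1), (0, -1)} \<Longrightarrow> support_fun Y (of_zvec e) \<le> C"
    and x: "x \<in> grid h \<inter> box_D" and y: "y \<in> grid h \<inter> box_D"
  shows "U x - U y \<le> 2 * C * dist x y"
proof -
  have step: "U (p + (h * of_int k) *\<^sub>R of_zvec e) - U p \<le> C * (h * \<bar>of_int k\<bar>)"
    if p: "p \<in> grid h" "p \<in> box_D" "p + (h * of_int k) *\<^sub>R of_zvec e \<in> box_D"
      and e: "e \<in> {(1, 0), (0, 1)}" for p k e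
  proof -
    define e' where "e' = (if k \<ge> 0 then e else - e)"
    have e': "e' \<in> {(1, 0), (-1, 0), (0, 1), (0, -1)}" using e by (auto simp: e'_def)
    have eq: "(h * of_int k) *\<^sub>R of_zvec e = (real (nat \<bar>k\<bar>) * h) *\<^sub>R of_zvec e'"
      by (simp add: e'_def)
    have "U (p + (h * of_int k) *\<^sub>R of_zvec e) - U p \<le>
        real (nat \<bar>k\<bar>) * (h * support_fun Y (of_zvec e'))"
      using slopes_bounded_line[OF S subsetD[OF V e'] p(1,2), of "nat \<bar>k\<bar>"] p(3)
      unfolding eq by blast
    also have "\<dots> \<le> real (nat \<bar>k\<bar>) * (h * C)"
      using C(2)[OF e'] h by (intro mult_left_mono) auto
    finally show ?thesis by (simp add: mult_ac)
  qed
  obtain a b where x': "x = h *\<^sub>R of_zvec (a, b)" using x by (auto simp: grid_def)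
  obtain c d where y': "y = h *\<^sub>R of_zvec (c, d)" using y by (auto simp: grid_def)
  let ?p = "h *\<^sub>R of_zvec (a, d)"
  have p: "?p \<in> grid h" "?p \<in> box_D" using x y by (auto simp: x' y' grid_def mem_box_D)
  have px: "?p + (h * of_int (b - d)) *\<^sub>R of_zvec (0, 1) = x"
    by (simp add: x' prod_eq_iff algebra_simps)
  have yp: "y + (h * of_int (a - c)) *\<^sub>R of_zvec (1, 0) = ?p"
    by (simp add: y' prod_eq_iff algebra_simps)
  have "U x - U ?p \<le> C * (h * \<bar>of_int (b - d)\<bar>)"
    using step[of ?p "b - d" "(0, 1)"] p x unfolding px by simp
  moreover have "U ?p - U y \<le> C * (h * \<bar>of_int (a - c)\<bar>)"
    using step[of y "a - c" "(1, 0)"] p y unfolding yp by simp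
  moreover have "h * \<bar>of_int (b - d)\<bar> = \<bar>snd (x - y)\<bar>" "h * \<bar>of_int (a - c)\<bar> = \<bar>fst (x - y)\<bar>"
    using h by (simp_all add: x' y' abs_mult flip: right_diff_distrib)
  moreover have "\<bar>snd (x - y)\<bar> \<le> dist x y" "\<bar>fst (x - y)\<bar> \<le> dist x y"
    using dist_fst_le[of x y] dist_snd_le[of x y] by (simp_all add: dist_real_def)
  then have "C * \<bar>snd (x - y)\<bar> \<le> C * dist x y" "C * \<bar>fst (x - y)\<bar> \<le> C * dist x y"
    using C(1) by (simp_all add: mult_left_mono)
  ultimately show ?thesis by simp
qed

lemma discrete_conj_ge:
  "h > 0 \<Longrightarrow> x \<in> grid h \<inter> box_D \<Longrightarrow> y \<bullet> x - U x \<le> discrete_conj h U y"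
  unfolding discrete_conj_def by (intro Max_ge finite_imageI finite_grid_box) auto

lemma discrete_conj_le:
  assumes "h > 0" "\<And>x. x \<in> grid h \<inter> box_D \<Longrightarrow> y \<bullet> x - U x \<le> c"
  shows "discrete_conj h U y \<le> c"
  unfolding discrete_conj_def using assms finite_grid_box[OF assms(1)] zero_in_grid zero_in_box_D
  by (subst Max_le_iff) auto

lemma closure_subset_outer_polygon: "bounded Y \<Longrightarrow> closure Y \<subseteq> outer_polygon Y V"
  by (auto simp: outer_polygon_def support_fun_upper)

lemma bounded_outer_polygon:
  assumes "{(1, 0), (-1, 0), (0, 1), (0, -1)} \<subseteq> V"
  shows "bounded (outer_polygon Y V)"
proof -
  let ?s = "\<lambda>e. \<bar>support_fun Y (of_zvec e)\<bar>"
  let ?M = "?s (1, 0) + ?s (-1, 0) + ?s (0, 1) + ?s (0, -1)"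
  have "outer_polygon Y V \<subseteq> cbox (- ?M, - ?M) (?M, ?M)"
  proof
    fix y assume "y \<in> outer_polygon Y V"
    then have "y \<bullet> of_zvec e \<le> support_fun Y (of_zvec e)"
      if "e \<in> {(1, 0), (-1, 0), (0, 1), (0, -1)}" for e
      using that assms by (auto simp: outer_polygon_def)
    from this[of "(1, 0)"] this[of "(-1, 0)"] this[of "(0, 1)"] this[of "(0, -1)"]
    show "y \<in> cbox (- ?M, - ?M) (?M, ?M)"
      by (cases y) (auto simp: of_zvec_def cbox_Pair_eq)
  qed
  then show ?thesis using bounded_cbox bounded_subset by blast
qed

lemma convex_ext_le:
  assumes "h > 0" "Y \<noteq> {}" "bounded Y" "x \<in> grid h \<inter> box_D"
  shows "convex_ext Y V h U x \<le> U x"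
proof -
  have "outer_polygon Y V \<noteq> {}"
    using closure_subset_outer_polygon[OF assms(3)] closure_subset assms(2) by blast
  moreover have "x \<bullet> y - discrete_conj h U y \<le> U x" for y
    using discrete_conj_ge[OF assms(1,4), of y U] by (simp add: inner_commute)
  ultimately show ?thesis unfolding convex_ext_def by (intro cSUP_least) auto
qed

lemma convex_ext_ge:
  assumes "h > 0" "{(1, 0), (-1, 0), (0, 1), (0, -1)} \<subseteq> V" "y \<in> outer_polygon Y V"
  shows "x \<bullet> y - discrete_conj h U y \<le> convex_ext Y V h U x"
  unfolding convex_ext_def
proof (rule cSUP_upper[OF assms(3)])
  obtain B where B: "\<And>y. y \<in> outer_polygon Y V \<Longrightarrow> norm y \<le> B"
    using bounded_outer_polygon[OF assms(2)] bounded_iff by blast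
  have "x \<bullet> y - discrete_conj h U y \<le> norm x * B + U 0" if "y \<in> outer_polygon Y V" for y
  proof -
    have "x \<bullet> y \<le> norm x * norm y" by (rule norm_cauchy_schwarz)
    also have "\<dots> \<le> norm x * B" using B[OF that] by (intro mult_left_mono) auto
    finally show ?thesis
      using discrete_conj_ge[OF assms(1), of 0 y U] zero_in_grid zero_in_box_D by simp
  qed
  then show "bdd_above ((\<lambda>y. x \<bullet> y - discrete_conj h U y) ` outer_polygon Y V)"
    by (rule bdd_aboveI2)
qed

section \<open>Limits of discretely convex grid functions\<close>

lemma scaled_floor_tendsto:
  fixes h :: "nat \<Rightarrow> real"
  assumes "\<And>k. 0 < h k" "h \<longlonglongrightarrow> 0"
  shows "(\<lambda>k. h k * real_of_int \<lfloor>c / h k\<rfloor>) \<longlonglongrightarrow> c"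
proof -
  have "norm (h k * real_of_int \<lfloor>c / h k\<rfloor> - c) \<le> h k" for k
  proof -
    have "real_of_int \<lfloor>c / h k\<rfloor> \<le> c / h k" "c / h k \<le> real_of_int \<lfloor>c / h k\<rfloor> + 1"
      by linarith+
    then have "h k * real_of_int \<lfloor>c / h k\<rfloor> \<le> h k * (c / h k)"
      "h k * (c / h k) \<le> h k * (real_of_int \<lfloor>c / h k\<rfloor> + 1)"
      using assms(1)[of k] by (intro mult_left_mono; simp)+
    then show ?thesis using assms(1)[of k] by (simp add: algebra_simps abs_le_iff)
  qed
  then have "(\<lambda>k. h k * real_of_int \<lfloor>c / h k\<rfloor> - c) \<longlonglongrightarrow> 0"
    by (intro Lim_null_comparison[OF _ assms(2)] always_eventually allI)
  then show ?thesis by (rule LIM_zero_cancel)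
qed

definition lattice_floor :: "real \<Rightarrow> plane \<Rightarrow> zvec" where
  "lattice_floor h x = (\<lfloor>fst x / h\<rfloor>, \<lfloor>snd x / h\<rfloor>)"

lemma lattice_floor_tendsto:
  assumes "\<And>k. 0 < h k" "h \<longlonglongrightarrow> 0"
  shows "(\<lambda>k. h k *\<^sub>R of_zvec (lattice_floor (h k) x)) \<longlonglongrightarrow> x"
  using tendsto_Pair[OF scaled_floor_tendsto[OF assms, of "fst x"]
      scaled_floor_tendsto[OF assms, of "snd x"]]
  by (simp add: lattice_floor_def of_zvec_def)

lemma uniform_limit_along_sequence:
  fixes l :: "'a::metric_space \<Rightarrow> real"
  assumes lim: "\<And>e. e > 0 \<Longrightarrow> \<forall>\<^sub>F k in sequentially. \<forall>x\<in>A k. \<bar>f k x - l x\<bar> < e"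
    and l: "continuous_on S l" and a: "a \<longlonglongrightarrow> x" "x \<in> S"
      "\<forall>\<^sub>F k in sequentially. a k \<in> S" "\<forall>\<^sub>F k in sequentially. a k \<in> A k"
  shows "(\<lambda>k. f k (a k)) \<longlonglongrightarrow> l x"
proof -
  have "(\<lambda>k. f k (a k) - l (a k)) \<longlonglongrightarrow> 0"
  proof (rule tendstoI)
    fix e :: real assume "e > 0"
    from lim[OF this] a(4) show "\<forall>\<^sub>F k in sequentially. dist (f k (a k) - l (a k)) 0 < e"
      by eventually_elim (simp add: dist_real_def)
  qed
  moreover have "(\<lambda>k. l (a k)) \<longlonglongrightarrow> l x"
    by (rule continuous_on_tendsto_compose[OF l a(1-3)])
  ultimately show ?thesis using tendsto_add by fastforce
qed

locale grid_limit =
  fixes h :: "nat \<Rightarrow> real" and U :: "nat \<Rightarrow> plane \<Rightarrow> real" and w :: "plane \<Rightarrow> real"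
  assumes h_pos: "\<And>k. 0 < h k" and h_lim: "h \<longlonglongrightarrow> 0"
    and U_convex: "\<And>k. grid_convex (h k) (U k)"
    and w_cont: "continuous_on box_D w"
    and U_lim: "\<And>e. e > 0 \<Longrightarrow>
      \<forall>\<^sub>F k in sequentially. \<forall>x\<in>grid (h k) \<inter> box_D. \<bar>U k x - w x\<bar> < e"
begin

lemma eventually_in_box:
  "a \<longlonglongrightarrow> x \<Longrightarrow> x \<in> interior box_D \<Longrightarrow> \<forall>\<^sub>F k in sequentially. a k \<in> box_D"
  using topological_tendstoD[of a x sequentially "interior box_D"] interior_subset
  by (auto elim!: eventually_mono)

lemma U_tendsto:
  assumes "a \<longlonglongrightarrow> x" "x \<in> interior box_D" "\<And>k. a k \<in> grid (h k)"
  shows "(\<lambda>k. U k (a k)) \<longlonglongrightarrow> w x"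
  using eventually_in_box[OF assms(1,2)] assms interior_subset
  by (intro uniform_limit_along_sequence[OF U_lim w_cont]) auto

lemma floor_in_grid: "h k *\<^sub>R of_zvec z \<in> grid (h k)"
  by (auto simp: grid_def)

lemma w_convex: "convex_on (interior box_D) w"
proof (rule midpoint_convex_imp_convex_on)
  show "continuous_on (interior box_D) w"
    using w_cont continuous_on_subset interior_subset by blast
  show conv_int: "convex (interior box_D)" by (intro convex_interior convex_box_D)
  fix x y assume x: "x \<in> interior box_D" and y: "y \<in> interior box_D"
  define m where "m = (1/2) *\<^sub>R (x + y)"
  define d where "d = (1/2) *\<^sub>R (y - x)"
  define a where "a = (\<lambda>k. h k *\<^sub>R of_zvec (lattice_floor (h k) m))"
  define z where "z = (\<lambda>k. lattice_floor (h k) d)"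
  have m: "m \<in> interior box_D"
    using convexD[OF conv_int x y, of "1/2" "1/2"] by (simp add: m_def scaleR_add_right)
  have a: "a \<longlonglongrightarrow> m" unfolding a_def by (rule lattice_floor_tendsto[OF h_pos h_lim])
  have b: "(\<lambda>k. h k *\<^sub>R of_zvec (z k)) \<longlonglongrightarrow> d"
    unfolding z_def by (rule lattice_floor_tendsto[OF h_pos h_lim])
  have md: "m + d = y" "m - d = x" by (simp_all add: m_def d_def prod_eq_iff field_simps)
  have ends: "(\<lambda>k. a k + h k *\<^sub>R of_zvec (z k)) \<longlonglongrightarrow> y" "(\<lambda>k. a k - h k *\<^sub>R of_zvec (z k)) \<longlonglongrightarrow> x"
    using tendsto_add[OF a b] tendsto_diff[OF a b] by (simp_all add: md)
  have grid: "a k \<in> grid (h k)" "a k + h k *\<^sub>R of_zvec (z k) \<in> grid (h k)"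
    "a k - h k *\<^sub>R of_zvec (z k) \<in> grid (h k)" for k
    using grid_step[of "a k" "h k" "z k"] grid_step[of "a k" "h k" "- z k"]
    by (simp_all add: a_def floor_in_grid)
  have "\<forall>\<^sub>F k in sequentially. 2 * U k (a k) \<le>
      U k (a k + h k *\<^sub>R of_zvec (z k)) + U k (a k - h k *\<^sub>R of_zvec (z k))"
    using eventually_in_box[OF ends(1) y] eventually_in_box[OF ends(2) x]
    by eventually_elim (rule grid_convex_midpoint[OF U_convex h_pos grid(1)])
  then show "2 * w m \<le> w x + w y"
    using tendsto_le[OF _ tendsto_add[OF U_tendsto[OF ends(1) y grid(2)] U_tendsto[OF ends(2) x grid(3)]]
        tendsto_mult_left[OF U_tendsto[OF a m grid(1)], of 2]] by (simp add: add.commute)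
qed

lemma w_slope:
  assumes S: "\<And>k. slopes_bounded Y (V k) (h k) (U k)" and e: "\<forall>\<^sub>F k in sequentially. e \<in> V k"
    and x: "x \<in> interior box_D" "x + t *\<^sub>R of_zvec e \<in> interior box_D" and t: "t > 0"
  shows "w (x + t *\<^sub>R of_zvec e) - w x \<le> t * support_fun Y (of_zvec e)"
proof -
  define a where "a = (\<lambda>k. h k *\<^sub>R of_zvec (lattice_floor (h k) x))"
  define m where "m = (\<lambda>k. nat \<lfloor>t / h k\<rfloor>)"
  have m_eq: "real (m k) * h k = h k * real_of_int \<lfloor>t / h k\<rfloor>" for k
    using t h_pos[of k] by (simp add: m_def)
  then have m: "(\<lambda>k. real (m k) * h k) \<longlonglongrightarrow> t"
    using scaled_floor_tendsto[OF h_pos h_lim, of t] by (simp only: m_eq)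
  have a: "a \<longlonglongrightarrow> x" unfolding a_def by (rule lattice_floor_tendsto[OF h_pos h_lim])
  have b: "(\<lambda>k. a k + (real (m k) * h k) *\<^sub>R of_zvec e) \<longlonglongrightarrow> x + t *\<^sub>R of_zvec e"
    by (intro tendsto_add a tendsto_scaleR m tendsto_const)
  have grid: "a k \<in> grid (h k)" "a k + (real (m k) * h k) *\<^sub>R of_zvec e \<in> grid (h k)" for k
    using grid_shift[of "a k" "h k" "int (m k)" e] by (simp_all add: a_def floor_in_grid)
  have "\<forall>\<^sub>F k in sequentially. U k (a k + (real (m k) * h k) *\<^sub>R of_zvec e) - U k (a k) \<le>
      (real (m k) * h k) * support_fun Y (of_zvec e)"
    using e eventually_in_box[OF a x(1)] eventually_in_box[OF b x(2)]
  proof eventually_elim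
    case (elim k)
    then show ?case using slopes_bounded_line[OF S elim(1) grid(1) elim(2,3)]
      by (simp add: mult_ac)
  qed
  then show ?thesis
    by (rule tendsto_le[rotated -1, OF _ _ tendsto_mult_right[OF m]
          tendsto_diff[OF U_tendsto[OF b x(2) grid(2)] U_tendsto[OF a x(1) grid(1)]]]) simp
qed

text \<open>The subgradients of the limit satisfy all slope constraints at once, hence lie in the closure
  of \<open>Y\<close>.  Such a subgradient is a competitor in the supremum that defines the convex extension,
  which therefore has no smaller limit than the grid functions.\<close>

lemma convex_ext_limit_eq:
  assumes S: "\<And>k. slopes_bounded Y (V k) (h k) (U k)" and Y: "Y \<noteq> {}" "bounded Y"
    and V: "\<And>k. {(1, 0), (-1, 0), (0, 1), (0, -1)} \<subseteq> V k"
    and W: "\<And>e. e \<in> W \<Longrightarrow> \<forall>\<^sub>F k in sequentially. e \<in> V k" "outer_polygon Y W \<subseteq> closure Y"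
    and v: "continuous_on box_D v"
      "uniform_limit box_D (\<lambda>k. convex_ext Y (V k) (h k) (U k)) v sequentially"
    and x: "x \<in> interior box_D"
  shows "v x = w x"
proof (rule antisym)
  let ?u = "\<lambda>k. convex_ext Y (V k) (h k) (U k)"
  have xbox: "x \<in> box_D" using x interior_subset by blast
  show "v x \<le> w x"
  proof -
    define a where "a = (\<lambda>k. h k *\<^sub>R of_zvec (lattice_floor (h k) x))"
    have a: "a \<longlonglongrightarrow> x" unfolding a_def by (rule lattice_floor_tendsto[OF h_pos h_lim])
    have grid: "a k \<in> grid (h k)" for k by (simp add: a_def floor_in_grid)
    have ev: "\<forall>\<^sub>F k in sequentially. a k \<in> box_D" by (rule eventually_in_box[OF a x])
    have "\<forall>\<^sub>F k in sequentially. \<forall>x\<in>box_D. \<bar>?u k x - v x\<bar> < e" if "e > 0" for e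
      using uniform_limitD[OF v(2) that] by (simp add: dist_real_def)
    then have u: "(\<lambda>k. ?u k (a k)) \<longlonglongrightarrow> v x"
      by (rule uniform_limit_along_sequence[OF _ v(1) a xbox ev ev])
    have "\<forall>\<^sub>F k in sequentially. ?u k (a k) \<le> U k (a k)"
      using ev by eventually_elim (use grid in \<open>auto intro: convex_ext_le[OF h_pos Y]\<close>)
    then show ?thesis
      by (rule tendsto_le[OF _ U_tendsto[OF a x grid] u, rotated]) simp
  qed
  obtain y where y: "\<And>z. z \<in> interior box_D \<Longrightarrow> w x + y \<bullet> (z - x) \<le> w z"
    using convex_on_subgradient[OF w_convex open_interior x] by blast
  have cl: "closure (interior box_D) = box_D"
    by (simp add: box_D_cbox closure_box box_ne_empty Basis_prod_def flip: zero_prod_def)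
  \<comment> \<open>The discrete conjugate also ranges over grid points on the boundary of the square.\<close>
  have y_box: "w x + y \<bullet> (z - x) \<le> w z" if "z \<in> box_D" for z
  proof -
    have "0 \<le> w z - (w x + y \<bullet> (z - x))"
      by (rule continuous_ge_on_closure[where S="interior box_D"])
        (use that y in \<open>auto simp: cl intro!: continuous_intros w_cont\<close>)
    then show ?thesis by simp
  qed
  have "y \<in> outer_polygon Y W"
    unfolding outer_polygon_def
  proof (intro CollectI ballI)
    fix e assume e: "e \<in> W"
    obtain d where d: "d > 0" "ball x d \<subseteq> interior box_D"
      using x open_interior open_contains_ball by blast
    define t where "t = d / (2 * (norm (of_zvec e) + 1))"
    have t: "t > 0" using d by (simp add: t_def add_nonneg_pos)
    have "norm (t *\<^sub>R of_zvec e) \<le> t * (norm (of_zvec e) + 1)" using t by simp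
    also have "\<dots> = d / 2"
      using norm_ge_zero[of "of_zvec e"] by (simp add: t_def field_simps add_nonneg_eq_0_iff)
    finally have "x + t *\<^sub>R of_zvec e \<in> ball x d" using d by (simp add: dist_norm)
    then have xt: "x + t *\<^sub>R of_zvec e \<in> interior box_D" using d by blast
    have "y \<bullet> (t *\<^sub>R of_zvec e) \<le> w (x + t *\<^sub>R of_zvec e) - w x"
      using y[OF xt] by simp
    also have "\<dots> \<le> t * support_fun Y (of_zvec e)"
      by (rule w_slope[OF S W(1)[OF e] x xt t])
    finally show "y \<bullet> of_zvec e \<le> support_fun Y (of_zvec e)" using t by simp
  qed
  then have yV: "y \<in> outer_polygon Y (V k)" for k
    using W(2) closure_subset_outer_polygon[OF Y(2)] by blast
  show "w x \<le> v x"
  proof (rule field_le_epsilon)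
    fix e :: real assume "e > 0"
    have "\<forall>\<^sub>F k in sequentially. w x - e \<le> ?u k x"
      using U_lim[OF \<open>e > 0\<close>]
    proof eventually_elim
      case (elim k)
      have "discrete_conj (h k) (U k) y \<le> y \<bullet> x - w x + e"
      proof (rule discrete_conj_le[OF h_pos])
        fix z assume z: "z \<in> grid (h k) \<inter> box_D"
        then show "y \<bullet> z - U k z \<le> y \<bullet> x - w x + e"
          using elim[rule_format, OF z] y_box[of z] by (simp add: inner_diff_right)
      qed
      then show ?case
        using convex_ext_ge[OF h_pos[of k] V[of k] yV[of k], of x "U k"] by (simp add: inner_commute)
    qed
    then have "w x - e \<le> v x"
      by (intro tendsto_lowerbound[OF tendsto_uniform_limitI[OF v(2) xbox]]) auto
    then show "w x \<le> v x + e" by simp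
  qed
qed

end

text \<open>Uniform Lipschitz bounds make the grid functions relatively compact, and every limit along a
  subsequence equals \<open>v\<close>; hence the whole sequence converges.\<close>

lemma grid_functions_converge:
  fixes h :: "nat \<Rightarrow> real" and U :: "nat \<Rightarrow> plane \<Rightarrow> real"
  assumes h: "\<And>k. 0 < h k" "h \<longlonglongrightarrow> 0"
    and U: "\<And>k. grid_convex (h k) (U k)" "\<And>k. slopes_bounded Y (V k) (h k) (U k)" "\<And>k. U k 0 = 0"
    and Y: "Y \<noteq> {}" "bounded Y"
    and V: "\<And>k. {(1, 0), (-1, 0), (0, 1), (0, -1)} \<subseteq> V k"
    and W: "\<And>e. e \<in> W \<Longrightarrow> \<forall>\<^sub>F k in sequentially. e \<in> V k" "outer_polygon Y W \<subseteq> closure Y"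
    and v: "continuous_on box_D v"
      "uniform_limit box_D (\<lambda>k. convex_ext Y (V k) (h k) (U k)) v sequentially"
    and e: "e > 0"
  shows "\<forall>\<^sub>F k in sequentially. \<forall>x\<in>grid (h k) \<inter> interior box_D. \<bar>U k x - v x\<bar> < e"
proof (rule ccontr)
  assume "\<not> ?thesis"
  from not_eventually_sequentiallyD[OF this] obtain s :: "nat \<Rightarrow> nat" where s: "strict_mono s"
    "\<And>n. \<not> (\<forall>x\<in>grid (h (s n)) \<inter> interior box_D. \<bar>U (s n) x - v x\<bar> < e)"
    by blast
  let ?s = "\<lambda>e. \<bar>support_fun Y (of_zvec e)\<bar>"
  define C where "C = ?s (1, 0) + ?s (-1, 0) + ?s (0, 1) + ?s (0, -1)"
  have C: "C \<ge> 0" "\<And>e. e \<in> {(1, 0), (-1, 0), (0, 1), (0, -1)} \<Longrightarrow> support_fun Y (of_zvec e) \<le> C"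
    by (auto simp: C_def)
  have "\<exists>F. (\<forall>x\<in>grid (h k) \<inter> box_D. F x = U k x) \<and> (\<forall>x y. \<bar>F x - F y\<bar> \<le> 2 * C * dist x y)" for k
  proof -
    have "grid (h k) \<inter> box_D \<noteq> {}" using zero_in_grid zero_in_box_D by blast
    then show ?thesis
      using finite_lipschitz_extension[OF finite_grid_box[OF h(1)[of k]] _ _
          slopes_bounded_lipschitz[OF U(2)[of k] h(1)[of k] V[of k] C]] C(1)
      by (metis mult_nonneg_nonneg zero_le_numeral)
  qed
  then obtain F where F: "\<And>k x. x \<in> grid (h k) \<inter> box_D \<Longrightarrow> F k x = U k x"
    "\<And>k x y. \<bar>F k x - F k y\<bar> \<le> 2 * C * dist x y" by metis
  obtain w q where w: "continuous_on box_D w" and q: "strict_mono (q :: nat \<Rightarrow> nat)"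
    and lim: "\<And>e. 0 < e \<Longrightarrow> \<exists>N. \<forall>n x. n \<ge> N \<and> x \<in> box_D \<longrightarrow> norm (F (s (q n)) x - w x) < e"
  proof (rule Arzela_Ascoli[OF compact_box_D, of "\<lambda>n. F (s n)" "2 * C * 2"])
    show "norm (F (s n) x) \<le> 2 * C * 2" if "x \<in> box_D" for n x
    proof -
      have "F (s n) 0 = 0" using F(1)[of 0] zero_in_grid zero_in_box_D U(3) by simp
      then have "norm (F (s n) x) \<le> 2 * C * norm x" using F(2)[of "s n" x 0] by simp
      moreover have "norm x \<le> 2"
        using norm_le_abs_components[of x] that by (simp add: mem_box_D)
      then have "2 * C * norm x \<le> 2 * C * 2" using C(1) by (intro mult_left_mono) auto
      ultimately show ?thesis by simp
    qed
    show "\<exists>d. 0 < d \<and> (\<forall>n y. y \<in> box_D \<and> norm (x - y) < d \<longrightarrow> norm (F (s n) x - F (s n) y) < e)"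
      if "0 < e" for x e
    proof (intro exI[of _ "e / (2 * C + 1)"] conjI allI impI)
      show "0 < e / (2 * C + 1)" using that C(1) by simp
      fix n y assume y: "y \<in> box_D \<and> norm (x - y) < e / (2 * C + 1)"
      have "norm (F (s n) x - F (s n) y) \<le> 2 * C * norm (x - y)"
        using F(2)[of "s n" x y] by (simp add: dist_norm)
      also have "\<dots> \<le> (2 * C + 1) * norm (x - y)" by (simp add: algebra_simps)
      also have "\<dots> < e" using y C(1) by (simp add: field_simps)
      finally show "norm (F (s n) x - F (s n) y) < e" .
    qed
  qed blast
  have sq: "filterlim (\<lambda>n. s (q n)) sequentially sequentially"
    using filterlim_compose[OF filterlim_subseq[OF s(1)] filterlim_subseq[OF q]] by simp
  have Flim: "\<forall>\<^sub>F k in sequentially. \<forall>x\<in>box_D. \<bar>F (s (q k)) x - w x\<bar> < e" if "e > 0" for e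
    using lim[OF that] unfolding eventually_sequentially real_norm_def by blast
  interpret grid_limit "\<lambda>k. h (s (q k))" "\<lambda>k. U (s (q k))" w
  proof
    show "(\<lambda>k. h (s (q k))) \<longlonglongrightarrow> 0" by (rule filterlim_compose[OF h(2) sq])
    show "\<forall>\<^sub>F k in sequentially. \<forall>x\<in>grid (h (s (q k))) \<inter> box_D. \<bar>U (s (q k)) x - w x\<bar> < e"
      if "e > 0" for e
      using Flim[OF that] by eventually_elim (metis F(1) IntD2)
  qed (use h U w in auto)
  have v_eq: "v x = w x" if "x \<in> interior box_D" for x
  proof (rule convex_ext_limit_eq[where V="\<lambda>k. V (s (q k))" and Y=Y and W=W, OF U(2) Y V _ W(2) v(1) _ that])
    show "\<forall>\<^sub>F k in sequentially. e \<in> V (s (q k))" if "e \<in> W" for e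
      using W(1)[OF that] sq by (rule eventually_compose_filterlim)
    show "uniform_limit box_D (\<lambda>k. convex_ext Y (V (s (q k))) (h (s (q k))) (U (s (q k)))) v sequentially"
      using filterlim_compose[OF v(2) sq] by simp
  qed
  obtain k where k: "\<forall>x\<in>grid (h (s (q k))) \<inter> box_D. \<bar>U (s (q k)) x - w x\<bar> < e"
    using eventually_happens'[OF sequentially_bot U_lim[OF e]] by blast
  have "\<bar>U (s (q k)) x - v x\<bar> < e" if "x \<in> grid (h (s (q k))) \<inter> interior box_D" for x
    using k v_eq[of x] that interior_subset[of box_D] by (metis IntD1 IntD2 IntI subsetD)
  then show False using s(2)[of "q k"] by blast
qed

section \<open>Difference quotients\<close>

lemma gradient_mean_value:
  fixes v :: "'a::real_inner \<Rightarrow> real"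
  assumes v: "\<And>x. GDERIV v x :> grad_v x" and s: "s > 0"
  obtains c where "0 < c" "c < s" "v (x + s *\<^sub>R d) - v x = s * (grad_v (x + c *\<^sub>R d) \<bullet> d)"
proof -
  have "((\<lambda>c. v (x + c *\<^sub>R d)) has_real_derivative grad_v (x + c *\<^sub>R d) \<bullet> d) (at c)" for c
  proof -
    have "((\<lambda>c. x + c *\<^sub>R d) has_derivative (\<lambda>t. t *\<^sub>R d)) (at c)"
      by (auto intro!: derivative_eq_intros)
    moreover have "(v has_derivative (\<lambda>t. t \<bullet> grad_v (x + c *\<^sub>R d))) (at (x + c *\<^sub>R d))"
      using v by (simp add: gderiv_def)
    ultimately have "((\<lambda>c. v (x + c *\<^sub>R d)) has_derivative
        (\<lambda>t. (t *\<^sub>R d) \<bullet> grad_v (x + c *\<^sub>R d))) (at c)"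
      by (rule has_derivative_compose)
    moreover have "(\<lambda>t. (t *\<^sub>R d) \<bullet> grad_v (x + c *\<^sub>R d)) = (*) (grad_v (x + c *\<^sub>R d) \<bullet> d)"
      by (simp add: fun_eq_iff inner_commute)
    ultimately show ?thesis by (simp only: has_field_derivative_def)
  qed
  then obtain c where "0 < c" "c < s"
    "v (x + s *\<^sub>R d) - v (x + 0 *\<^sub>R d) = (s - 0) * (grad_v (x + c *\<^sub>R d) \<bullet> d)"
    using MVT2[OF s, of "\<lambda>c. v (x + c *\<^sub>R d)" "\<lambda>c. grad_v (x + c *\<^sub>R d) \<bullet> d"] by blast
  then show ?thesis using that by simp
qed

text \<open>Convexity along lattice lines bounds the difference quotient at scale \<open>h\<close> by the one at a
  fixed scale \<open>t\<close>; the latter tolerates an error of order \<open>\<epsilon> / t\<close> in the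
  values, and is close to the directional derivative of \<open>v\<close> when \<open>t\<close> is small.\<close>

lemma forward_quotient_le:
  fixes h :: "nat \<Rightarrow> real"
  assumes h: "\<And>k. 0 < h k" "h \<longlonglongrightarrow> 0"
    and U: "\<And>k. grid_convex (h k) (U k)"
      "\<And>e. e > 0 \<Longrightarrow> \<forall>\<^sub>F k in sequentially. \<forall>x\<in>grid (h k) \<inter> interior box_D. \<bar>U k x - v x\<bar> < e"
    and v: "\<And>x. GDERIV v x :> grad_v x" "continuous_on UNIV grad_v"
    and K: "compact K" "K \<subseteq> interior box_D" and e: "irreducible_zvec e" and \<eta>: "\<eta> > 0"
  shows "\<forall>\<^sub>F k in sequentially. \<forall>x\<in>K \<inter> grid (h k).
    fdiff (h k) e (U k) x \<le> h k * (grad_v x \<bullet> of_zvec e + \<eta>)"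
proof -
  let ?d = "of_zvec e"
  obtain \<rho> where \<rho>: "\<rho> > 0" "(\<Union>x\<in>K. ball x \<rho>) \<subseteq> interior box_D"
    using compact_subset_open_imp_ball_epsilon_subset[OF K(1) open_interior K(2)] by blast
  have "uniformly_continuous_on box_D grad_v"
    using v(2) by (intro compact_uniformly_continuous compact_box_D) (rule continuous_on_subset, auto)
  moreover define N where "N = norm ?d + 1"
  have N: "N > 0" "norm ?d \<le> N" by (simp_all add: N_def add_nonneg_pos)
  define \<eta>' where "\<eta>' = \<eta> / (2 * N)"
  then have \<eta>': "\<eta>' > 0" "\<eta>' * N = \<eta> / 2" using \<eta> N by (simp_all add: \<eta>'_def)
  ultimately obtain \<delta> where \<delta>: "\<delta> > 0"
    "\<And>x y. x \<in> box_D \<Longrightarrow> y \<in> box_D \<Longrightarrow> dist y x < \<delta> \<Longrightarrow> dist (grad_v y) (grad_v x) < \<eta>'"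
    unfolding uniformly_continuous_on_def by meson
  define t where "t = min \<rho> \<delta> / (2 * N)"
  have t: "t > 0" using \<rho>(1) \<delta>(1) N by (simp add: t_def)
  have near: "x + c *\<^sub>R ?d \<in> ball x \<rho>" "dist (x + c *\<^sub>R ?d) x < \<delta>" if "0 \<le> c" "c \<le> t" for x c
  proof -
    have "norm (c *\<^sub>R ?d) \<le> t * N" using that t N by (simp add: mult_mono)
    also have "\<dots> = min \<rho> \<delta> / 2" using N by (simp add: t_def)
    also have "\<dots> < min \<rho> \<delta>" using \<rho>(1) \<delta>(1) by linarith
    finally show "x + c *\<^sub>R ?d \<in> ball x \<rho>" "dist (x + c *\<^sub>R ?d) x < \<delta>" by (simp_all add: dist_norm)
  qed
  have quot: "v (x + s *\<^sub>R ?d) - v x \<le> s * (grad_v x \<bullet> ?d + \<eta> / 2)"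
    if x: "x \<in> K" and s: "0 < s" "s \<le> t" for x s
  proof -
    obtain c where c: "0 < c" "c < s" "v (x + s *\<^sub>R ?d) - v x = s * (grad_v (x + c *\<^sub>R ?d) \<bullet> ?d)"
      using gradient_mean_value[OF v(1) s(1)] by blast
    have "x + c *\<^sub>R ?d \<in> ball x \<rho>" using near(1) c s by simp
    then have "x \<in> box_D" "x + c *\<^sub>R ?d \<in> box_D"
      using x K(2) \<rho>(2) interior_subset[of box_D] by blast+
    then have "norm (grad_v (x + c *\<^sub>R ?d) - grad_v x) \<le> \<eta>'"
      using \<delta>(2)[of x "x + c *\<^sub>R ?d"] near(2)[of c x] c(1,2) s(2) unfolding dist_norm by linarith
    then have "(grad_v (x + c *\<^sub>R ?d) - grad_v x) \<bullet> ?d \<le> \<eta>' * N"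
      using norm_cauchy_schwarz[of "grad_v (x + c *\<^sub>R ?d) - grad_v x" ?d] \<eta>'(1) N
      by (smt (verit) mult_mono norm_ge_zero)
    then show ?thesis unfolding c(3) \<eta>'(2) using s by (simp add: inner_diff_left)
  qed
  have "t * \<eta> / 8 > 0" using t \<eta> by simp
  from U(2)[OF this] have ev: "\<forall>\<^sub>F k in sequentially. \<forall>x\<in>grid (h k) \<inter> interior box_D. \<bar>U k x - v x\<bar> < t * \<eta> / 8" .
  have "\<forall>\<^sub>F k in sequentially. h k < t / 2" using order_tendstoD(2)[OF h(2), of "t/2"] t by simp
  with ev show ?thesis
  proof eventually_elim
    case (elim k)
    show ?case
    proof
      fix x assume x: "x \<in> K \<inter> grid (h k)"
      \<comment> \<open>\<open>s\<close> is the largest multiple of \<open>h k\<close> up to \<open>t\<close>; it is at least \<open>t / 2\<close> since \<open>h k < t / 2\<close>.\<close>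
      define m where "m = nat \<lfloor>t / h k\<rfloor>"
      define s where "s = real m * h k"
      have fl: "real m \<le> t / h k" "t / h k < real m + 1" using t h(1)[of k] by (auto simp: m_def)
      have s: "s \<le> t" "t / 2 \<le> s"
        using fl elim(2) h(1)[of k] by (auto simp: s_def field_simps)
      then have m: "m > 0" using t by (auto simp: s_def intro: gr0I)
      have s0: "s > 0" using s t by simp
      let ?y = "x + s *\<^sub>R ?d"
      have xi: "x \<in> grid (h k) \<inter> interior box_D" using x K(2) by auto
      have "?y \<in> ball x \<rho>" using near(1) s s0 by simp
      moreover have "?y \<in> grid (h k)" using grid_shift[of x "h k" "int m" e] x by (simp add: s_def)
      ultimately have yi: "?y \<in> grid (h k) \<inter> interior box_D" using \<rho>(2) x by blast
      have "real m * fdiff (h k) e (U k) x \<le> U k ?y - U k x"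
        using grid_convex_chord[OF U(1)[of k] h(1)[of k] _ _ e, where m=m, of x] xi yi m interior_subset[of box_D]
        by (auto simp: fdiff_def s_def)
      also have "\<dots> \<le> v ?y - v x + t * \<eta> / 4"
        using elim(1)[rule_format, OF xi] elim(1)[rule_format, OF yi] unfolding abs_less_iff by linarith
      also have "\<dots> \<le> s * (grad_v x \<bullet> ?d + \<eta> / 2) + s * (\<eta> / 2)"
      proof (intro add_mono quot)
        show "t * \<eta> / 4 \<le> s * (\<eta> / 2)"
          using mult_right_mono[OF s(2), of "\<eta> / 2"] \<eta> by simp
      qed (use x s s0 in auto)
      also have "\<dots> = real m * (h k * (grad_v x \<bullet> ?d + \<eta>))" by (simp add: s_def algebra_simps)
      finally show "fdiff (h k) e (U k) x \<le> h k * (grad_v x \<bullet> ?d + \<eta>)" using m by simp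
    qed
  qed
qed

text \<open>The lower bound is the upper bound in the opposite direction, since second differences are
  nonnegative.\<close>

lemma quotient_converges:
  fixes h :: "nat \<Rightarrow> real"
  assumes h: "\<And>k. 0 < h k" "h \<longlonglongrightarrow> 0"
    and U: "\<And>k. grid_convex (h k) (U k)"
      "\<And>e. e > 0 \<Longrightarrow> \<forall>\<^sub>F k in sequentially. \<forall>x\<in>grid (h k) \<inter> interior box_D. \<bar>U k x - v x\<bar> < e"
    and v: "\<And>x. GDERIV v x :> grad_v x" "continuous_on UNIV grad_v"
    and K: "compact K" "K \<subseteq> interior box_D" and e: "irreducible_zvec e" and \<eta>: "\<eta> > 0"
  shows "\<forall>\<^sub>F k in sequentially. \<forall>x\<in>K \<inter> grid (h k).
    \<bar>fdiff (h k) e (U k) x / h k - grad_v x \<bullet> of_zvec e\<bar> \<le> \<eta> \<and>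
    \<bar>fdiff (h k) (- e) (U k) x / h k + grad_v x \<bullet> of_zvec e\<bar> \<le> \<eta>"
proof -
  let ?d = "of_zvec e"
  obtain \<rho> where \<rho>: "\<rho> > 0" "(\<Union>x\<in>K. ball x \<rho>) \<subseteq> interior box_D"
    using compact_subset_open_imp_ball_epsilon_subset[OF K(1) open_interior K(2)] by blast
  have e': "irreducible_zvec (- e)" using e by (simp add: irreducible_zvec_def)
  have "(\<lambda>k. norm (h k *\<^sub>R ?d)) \<longlonglongrightarrow> norm (0 *\<^sub>R ?d)"
    by (intro tendsto_intros h)
  then have "\<forall>\<^sub>F k in sequentially. norm (h k *\<^sub>R ?d) < \<rho>"
    using order_tendstoD(2) \<rho>(1) by fastforce
  moreover have "\<forall>\<^sub>F k in sequentially. \<forall>x\<in>K \<inter> grid (h k).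
      fdiff (h k) e (U k) x \<le> h k * (grad_v x \<bullet> of_zvec e + \<eta>)"
    by (rule forward_quotient_le[OF h U v K e \<eta>])
  moreover have "\<forall>\<^sub>F k in sequentially. \<forall>x\<in>K \<inter> grid (h k).
      fdiff (h k) (- e) (U k) x \<le> h k * (grad_v x \<bullet> of_zvec (- e) + \<eta>)"
    by (rule forward_quotient_le[OF h U v K e' \<eta>])
  ultimately show ?thesis
  proof eventually_elim
    case (elim k)
    show ?case
    proof
      fix x assume x: "x \<in> K \<inter> grid (h k)"
      have "x + h k *\<^sub>R ?d \<in> ball x \<rho>" "x - h k *\<^sub>R ?d \<in> ball x \<rho>"
        using elim(1) by (simp_all add: dist_norm)
      then have "admissible (h k) x e"
        unfolding admissible_def using \<rho>(2) x interior_subset[of box_D] by blast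
      moreover have "x \<in> grid (h k) \<inter> box_D" using x K(2) interior_subset[of box_D] by blast
      ultimately have "0 \<le> sdiff (h k) e (U k) x"
        using U(1)[of k, unfolded grid_convex_def, rule_format, OF _ e] by blast
      then have sum: "0 \<le> fdiff (h k) e (U k) x / h k + fdiff (h k) (- e) (U k) x / h k"
        using h(1)[of k] by (simp add: sdiff_def flip: add_divide_distrib)
      have "fdiff (h k) e (U k) x / h k \<le> grad_v x \<bullet> ?d + \<eta>"
        "fdiff (h k) (- e) (U k) x / h k \<le> - (grad_v x \<bullet> ?d) + \<eta>"
        using elim(2,3) x h(1)[of k] by (auto simp: pos_divide_le_eq mult.commute)
      with sum show "\<bar>fdiff (h k) e (U k) x / h k - grad_v x \<bullet> ?d\<bar> \<le> \<eta> \<and>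
          \<bar>fdiff (h k) (- e) (U k) x / h k + grad_v x \<bullet> ?d\<bar> \<le> \<eta>"
        unfolding abs_le_iff by linarith
    qed
  qed
qed

lemma max_on_tendsto_0:
  assumes fin: "\<And>k. finite (A k)" and nonneg: "\<And>k x. 0 \<le> F k x"
    and small: "\<And>e. e > 0 \<Longrightarrow> \<forall>\<^sub>F k in sequentially. \<forall>x\<in>A k. F k x \<le> e"
  shows "(\<lambda>k. max_on (A k) (F k)) \<longlonglongrightarrow> 0"
proof (rule tendstoI)
  fix e :: real assume "e > 0"
  then obtain d where d: "0 < d" "d < e" using dense by blast
  from small[OF d(1)] show "\<forall>\<^sub>F k in sequentially. dist (max_on (A k) (F k)) 0 < e"
  proof eventually_elim
    case (elim k)
    have "0 \<le> max_on (A k) (F k)"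
      using fin[of k] nonneg[of k] by (auto simp: max_on_def Max_ge_iff ex_in_conv)
    moreover have "max_on (A k) (F k) \<le> d"
      using fin[of k] elim d(1) by (auto simp: max_on_def)
    ultimately show ?case using d(2) by (simp add: dist_real_def)
  qed
qed

section \<open>Convergence of the discrete gradients\<close>

theorem propositionA5:
  fixes X Y :: "plane set"
    and f g :: "plane \<Rightarrow> real"
    and mf Mf mg Mg :: real
    and h :: "nat \<Rightarrow> real"
    and V :: "nat \<Rightarrow> zvec set"
    and G :: "nat \<Rightarrow> (plane \<Rightarrow> real) \<Rightarrow> plane \<Rightarrow> plane"
    and U :: "nat \<Rightarrow> plane \<Rightarrow> real"
    and r :: "nat \<Rightarrow> nat"
    and v :: "plane \<Rightarrow> real"
    and grad_v :: "plane \<Rightarrow> plane"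
    and K :: "plane set"
  assumes X: "open X" "bounded X" "0 \<in> X" "closure X \<subseteq> interior box_D"
    and Y: "Y \<noteq> {}" "open Y" "bounded Y" "convex Y"
    and bounds: "0 < mf" "0 < Mf" "0 < mg" "0 < Mg"
    and f: "integrable lebesgue f" "(LINT x|lebesgue. f x) = 1"
           "\<And>x. x \<notin> X \<Longrightarrow> f x = 0" "\<And>x. x \<in> X \<Longrightarrow> mf \<le> f x \<and> f x \<le> Mf"
    and g: "continuous_on UNIV g" "\<And>y. mg \<le> g y \<and> g y \<le> Mg"
           "(LINT y:Y|lebesgue. g y) = 1"
    and h: "\<And>n. 0 < h n" "decseq h" "h \<longlonglongrightarrow> 0"
    and V: "\<And>n. finite (V n)" "\<And>n e. e \<in> V n \<Longrightarrow> irreducible_zvec e"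
           "\<And>n. {(1, 0), (-1, 0), (0, 1), (0, -1)} \<subseteq> V n"
           "\<And>n n'. n \<le> n' \<Longrightarrow> V n \<subseteq> V n'"
           "(\<Inter>n. outer_polygon Y (V n)) = closure Y"
           "\<And>n x e. x \<in> closure X \<Longrightarrow> e \<in> V n \<Longrightarrow> x + h n *\<^sub>R of_zvec e \<in> box_D"
    and U: "\<And>n. solves_scheme X Y f g (V n) (G n) (h n) (U n)"
    and r: "strict_mono r"
    and conv: "\<And>C. compact C \<Longrightarrow>
           uniform_limit C (\<lambda>k. convex_ext Y (V (r k)) (h (r k)) (U (r k))) v sequentially"
    and v: "\<And>x. GDERIV v x :> grad_v x" "continuous_on UNIV grad_v"
    and K: "compact K" "K \<subseteq> interior box_D"
  shows "(\<lambda>k. max_on (K \<inter> grid (h (r k)))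
            (\<lambda>x. norm (grad_C (h (r k)) (U (r k)) x - grad_v x))) \<longlonglongrightarrow> 0 \<and>
         (\<lambda>k. max_on (K \<inter> grid (h (r k)))
            (\<lambda>x. norm (grad_F (h (r k)) (U (r k)) x - grad_v x))) \<longlonglongrightarrow> 0 \<and>
         (\<lambda>k. max_on (K \<inter> grid (h (r k)))
            (\<lambda>x. norm (grad_B (h (r k)) (U (r k)) x - grad_v x))) \<longlonglongrightarrow> 0"
proof -
  define h' where "h' = (\<lambda>k. h (r k))"
  define U' where "U' = (\<lambda>k. U (r k))"
  define V' where "V' = (\<lambda>k. V (r k))"
  have h': "\<And>k. 0 < h' k" "h' \<longlonglongrightarrow> 0"
    using h(1) filterlim_compose[OF h(3) filterlim_subseq[OF r]] by (auto simp: h'_def)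
  have XV: "x + h n *\<^sub>R of_zvec e \<in> box_D" if "x \<in> X" "e \<in> V n" for x e n
    using V(6) that closure_subset by blast
  have gpos: "0 < g y" for y using g(2)[of y] bounds by linarith
  have conv_n: "grid_convex (h n) (U n)" for n
    by (rule scheme_grid_convex[OF U h(1) X(1) f(1) bounds(1) f(3) _ gpos V(1,3) XV]) (use f(4) in auto)
  then have conv': "\<And>k. grid_convex (h' k) (U' k)" by (simp add: h'_def U'_def)
  have slope': "\<And>k. slopes_bounded Y (V' k) (h' k) (U' k)"
    unfolding V'_def h'_def U'_def
    by (rule scheme_slopes_bounded[OF U h(1) conv_n Y(1,3) V(1,2) XV])
  have zero': "\<And>k. U' k 0 = 0" using U by (simp add: U'_def solves_scheme_def)
  have V'_axes: "\<And>k. {(1, 0), (-1, 0), (0, 1), (0, -1)} \<subseteq> V' k" using V(3) by (simp add: V'_def)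
  have W: "\<forall>\<^sub>F k in sequentially. e \<in> V' k" if e: "e \<in> (\<Union>n. V n)" for e
  proof -
    obtain n where "e \<in> V n" using e by blast
    then have "e \<in> V' k" if "k \<ge> n" for k
      using V(4)[of n "r k"] seq_suble[OF r, of k] that by (auto simp: V'_def)
    then show ?thesis by (auto simp: eventually_sequentially)
  qed
  have WY: "outer_polygon Y (\<Union>n. V n) \<subseteq> closure Y"
    unfolding V(5)[symmetric] by (auto simp: outer_polygon_def)
  have "continuous (at x) v" for x
    using v(1)[of x] has_derivative_continuous unfolding gderiv_def by blast
  then have v_cont: "continuous_on box_D v" by (simp add: continuous_at_imp_continuous_on)
  have v_lim: "uniform_limit box_D (\<lambda>k. convex_ext Y (V' k) (h' k) (U' k)) v sequentially"
    using conv[OF compact_box_D] by (simp add: V'_def h'_def U'_def)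
  have U'_lim: "\<And>e. e > 0 \<Longrightarrow> \<forall>\<^sub>F k in sequentially.
      \<forall>x\<in>grid (h' k) \<inter> interior box_D. \<bar>U' k x - v x\<bar> < e"
    by (rule grid_functions_converge[OF h' conv' slope' zero' Y(1,3) V'_axes W WY v_cont v_lim])
  have fin: "finite (K \<inter> grid (h' k))" for k
    using finite_grid_box[OF h'(1), of k] K(2) interior_subset by (rule_tac finite_subset) auto
  have quot: "\<forall>\<^sub>F k in sequentially. \<forall>x\<in>K \<inter> grid (h' k).
      \<bar>fdiff (h' k) (1, 0) (U' k) x / h' k - fst (grad_v x)\<bar> \<le> \<eta> \<and>
      \<bar>fdiff (h' k) (-1, 0) (U' k) x / h' k + fst (grad_v x)\<bar> \<le> \<eta> \<and>
      \<bar>fdiff (h' k) (0, 1) (U' k) x / h' k - snd (grad_v x)\<bar> \<le> \<eta> \<and>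
      \<bar>fdiff (h' k) (0, -1) (U' k) x / h' k + snd (grad_v x)\<bar> \<le> \<eta>" if \<eta>: "\<eta> > 0" for \<eta>
  proof -
    have irr: "irreducible_zvec (1, 0)" "irreducible_zvec (0, 1)" by (simp_all add: irreducible_zvec_def)
    have ip: "y \<bullet> of_zvec (1, 0) = fst y" "y \<bullet> of_zvec (0, 1) = snd y" for y :: plane
      by (simp_all add: inner_prod_def)
    have q: "\<forall>\<^sub>F k in sequentially. \<forall>x\<in>K \<inter> grid (h' k).
        \<bar>fdiff (h' k) e (U' k) x / h' k - grad_v x \<bullet> of_zvec e\<bar> \<le> \<eta> \<and>
        \<bar>fdiff (h' k) (- e) (U' k) x / h' k + grad_v x \<bullet> of_zvec e\<bar> \<le> \<eta>"
      if "irreducible_zvec e" for e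
      by (rule quotient_converges[OF h' conv' U'_lim v K that \<eta>])
    from q[OF irr(1)] q[OF irr(2)]
    show ?thesis by eventually_elim (simp add: ip)
  qed
  have close: "(\<lambda>k. max_on (K \<inter> grid (h' k)) (\<lambda>x. norm (D (h' k) (U' k) x - grad_v x))) \<longlonglongrightarrow> 0"
    if D: "\<And>k x \<eta>. \<bar>fdiff (h' k) (1, 0) (U' k) x / h' k - fst (grad_v x)\<bar> \<le> \<eta> \<Longrightarrow>
      \<bar>fdiff (h' k) (-1, 0) (U' k) x / h' k + fst (grad_v x)\<bar> \<le> \<eta> \<Longrightarrow>
      \<bar>fdiff (h' k) (0, 1) (U' k) x / h' k - snd (grad_v x)\<bar> \<le> \<eta> \<Longrightarrow>
      \<bar>fdiff (h' k) (0, -1) (U' k) x / h' k + snd (grad_v x)\<bar> \<le> \<eta> \<Longrightarrow>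
      \<bar>fst (D (h' k) (U' k) x) - fst (grad_v x)\<bar> \<le> \<eta> \<and> \<bar>snd (D (h' k) (U' k) x) - snd (grad_v x)\<bar> \<le> \<eta>"
    for D
  proof (rule max_on_tendsto_0[OF fin])
    fix e :: real assume "e > 0"
    then have "e / 2 > 0" by simp
    from quot[OF this] show "\<forall>\<^sub>F k in sequentially. \<forall>x\<in>K \<inter> grid (h' k).
        norm (D (h' k) (U' k) x - grad_v x) \<le> e"
    proof eventually_elim
      case (elim k)
      show ?case
      proof
        fix x assume "x \<in> K \<inter> grid (h' k)"
        then have "\<bar>fst (D (h' k) (U' k) x) - fst (grad_v x)\<bar> \<le> e / 2 \<and>
            \<bar>snd (D (h' k) (U' k) x) - snd (grad_v x)\<bar> \<le> e / 2"
          using elim by (intro D) auto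
        then show "norm (D (h' k) (U' k) x - grad_v x) \<le> e"
          using norm_le_abs_components[of "D (h' k) (U' k) x - grad_v x"] by simp
      qed
    qed
  qed simp
  have half: "\<bar>(a - b) / (2 * h' k) - c\<bar> \<le> \<eta>"
    if "\<bar>a / h' k - c\<bar> \<le> \<eta>" "\<bar>b / h' k + c\<bar> \<le> \<eta>" for a b c \<eta> k
  proof -
    have eq: "(a - b) / (2 * h' k) - c = ((a / h' k - c) - (b / h' k + c)) / 2"
      by (simp add: diff_divide_distrib)
    have "\<bar>(p - q) / 2\<bar> \<le> \<eta>" if "\<bar>p\<bar> \<le> \<eta>" "\<bar>q\<bar> \<le> \<eta>" for p q
      using that unfolding abs_le_iff by (simp add: field_simps)
    from this[OF that] show ?thesis unfolding eq .
  qed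
  have neg: "\<bar>- b / h' k - c\<bar> = \<bar>b / h' k + c\<bar>" for b c k
    using abs_minus_cancel[of "b / h' k + c"] by simp
  show ?thesis
    using close[of grad_C] close[of grad_F] close[of grad_B] half neg
    by (simp add: grad_C_def grad_F_def grad_B_def h'_def U'_def)
qed

end
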